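(* Let $A\in\mathbb{R}^{m\times n}$ have simple singular values $\sigma_1>\cdots>\sigma_n>0$ and $b\in\mathbb{R}^m$. Let $\alpha_j,\beta_{j+1}$ be the diagonal and subdiagonal entries of the bidiagonal matrices generated by Lanczos bidiagonalization, let $\gamma_k=\|A-P_{k+1}B_kQ_k^T\|$, and let $\eta_k$ be as defined in the context. Then $$\alpha_{k+1}<\gamma_k\le\sqrt{1+\eta_k^2}\,\sigma_{k+1},\quad k=1,2,\dots,n-1,$$ $$\beta_{k+2}<\gamma_k\le\sqrt{1+\eta_k^2}\,\sigma_{k+1},\quad k=1,2,\dots,n-1,$$ $$\alpha_{k+1}\beta_{k+2}\le\frac{\gamma_k^2}{2}\le\frac{(1+\eta_k^2)\sigma_{k+1}^2}{2},\quad k=1,2,\dots,n-1,$$ $$\gamma_{k+1}<\gamma_k,\quad k=1,2,\dots,n-2.$$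
   Context: $\|\cdot\|$ is the 2-norm. The SVD of $A$ is $A=U\begin{pmatrix}\Sigma\\ \mathbf{0}\end{pmatrix}V^T$ with $U=(u_1,\dots,u_m)$, $V=(v_1,\dots,v_n)$ orthogonal, $\Sigma=\mathrm{diag}(\sigma_1,\dots,\sigma_n)$; $\Sigma_k=\mathrm{diag}(\sigma_1,\dots,\sigma_k)$. Lanczos bidiagonalization: $p_1=b/\|b\|$, $\beta_1q_0=0$; for $j=1,2,\dots$: $r=A^Tp_j-\beta_jq_{j-1}$, $\alpha_j=\|r\|$, $q_j=r/\alpha_j$, $z=Aq_j-\alpha_jp_j$, $\beta_{j+1}=\|z\|$, $p_{j+1}=z/\beta_{j+1}$. $P_{k+1}=(p_1,\dots,p_{k+1})$, $Q_k=(q_1,\dots,q_k)$ have orthonormal columns, and $B_k=P_{k+1}^TAQ_k\in\mathbb{R}^{(k+1)\times k}$ is lower bidiagonal with diagonal $\alpha_1,\dots,\alpha_k$ and subdiagonal $\beta_2,\dots,\beta_{k+1}$; $AQ_k=P_{k+1}B_k$. It is assumed that $b$ has nonzero components in all left singular vectors $u_1,\dots,u_n$ and that Lanczos bidiagonalization can be run to completion, producing $P_{n+1},Q_n,B_n$ with all $\alpha_i,\beta_{i+1}>0$, $i=1,\dots,n$ (so $m>n$). Definition of $\Delta_k\in\mathbb{R}^{(n-k)\times k}$: let $D=\mathrm{diag}(\sigma_iu_i^Tb)\in\mathbb{R}^{n\times n}$ and let $T_k\in\mathbb{R}^{n\times k}$ have $i$-th row $(1,\sigma_i^2,\dots,\sigma_i^{2k-2})$.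 Partition $D=\mathrm{diag}(D_1,D_2)$ with $D_1\in\mathbb{R}^{k\times k}$ and $T_k=\begin{pmatrix}T_{k1}\\ T_{k2}\end{pmatrix}$ with $T_{k1}\in\mathbb{R}^{k\times k}$ (nonsingular). Then $\Delta_k=D_2T_{k2}T_{k1}^{-1}D_1^{-1}$. Definition of $\eta_k\ge0$: $\eta_k^2\sigma_{k+1}^2=\|\Sigma_k(I+\Delta_k^T\Delta_k)^{-1}\Delta_k^T\Delta_k\|^2+\|\Sigma_k(I+\Delta_k^T\Delta_k)^{-1}\Delta_k^T\|^2$. *)

theory Defs
  imports Complex_Main "Jordan_Normal_Form.Gauss_Jordan_Elimination"
begin

text \<open>Rows and columns of the library matrices are indexed from 0, whereas the sequences
  \<open>\<sigma>\<close>, \<open>\<alpha>\<close>, \<open>\<beta>\<close>, \<open>p\<close>, \<open>q\<close> below are indexed from 1.  So \<open>\<sigma> (Suc i)\<close> goes with column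
  \<open>col U i\<close>, which is the left singular vector $u_{i+1}$.\<close>

definition vec_norm2 :: "real vec \<Rightarrow> real" where
  "vec_norm2 v = sqrt (v \<bullet> v)"

text \<open>The same supremum as in \<open>onorm\<close> of the analysis library; the quotient is 0 for \<open>x = 0\<close>.\<close>

definition mat_norm2 :: "real mat \<Rightarrow> real" where
  "mat_norm2 M = (SUP x\<in>carrier_vec (dim_col M). vec_norm2 (M *\<^sub>v x) / vec_norm2 x)"

definition orthogonal_matrix2 :: "nat \<Rightarrow> real mat \<Rightarrow> bool" where
  "orthogonal_matrix2 n U \<longleftrightarrow>
     U \<in> carrier_mat n n \<and> transpose_mat U * U = 1\<^sub>m n \<and> U * transpose_mat U = 1\<^sub>m n"

text \<open>Positivity and strict ordering of the \<open>\<sigma> i\<close> are not part of this predicate.\<close>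

definition is_svd :: "nat \<Rightarrow> nat \<Rightarrow> real mat \<Rightarrow> real mat \<Rightarrow> (nat \<Rightarrow> real) \<Rightarrow> real mat \<Rightarrow> bool" where
  "is_svd m n A U \<sigma> V \<longleftrightarrow>
     n \<le> m \<and> orthogonal_matrix2 m U \<and> orthogonal_matrix2 n V \<and>
     A = U * (mat_diag n (\<lambda>i. \<sigma> (Suc i)) @\<^sub>r 0\<^sub>m (m - n) n) * transpose_mat V"


text \<open>\<open>lanczos A b j\<close> is $(\alpha_j, q_j, \beta_{j+1}, p_{j+1})$.  The values $\alpha_0$ and
  $\beta_1$ are placeholders; $\beta_1$ only occurs in the product $\beta_1 q_0 = 0$.
  After a breakdown (zero norm) the convention \<open>1 / 0 = 0\<close> yields zero vectors.\<close>

fun lanczos :: "real mat \<Rightarrow> real vec \<Rightarrow> nat \<Rightarrow> real \<times> real vec \<times> real \<times> real vec" where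
  "lanczos A b 0 = (0, 0\<^sub>v (dim_col A), 0, (1 / vec_norm2 b) \<cdot>\<^sub>v b)"
| "lanczos A b (Suc j) =
     (case lanczos A b j of (_, q, \<beta>, p) \<Rightarrow>
        let r = transpose_mat A *\<^sub>v p - \<beta> \<cdot>\<^sub>v q;
            \<alpha> = vec_norm2 r;
            q' = (1 / \<alpha>) \<cdot>\<^sub>v r;
            z = A *\<^sub>v q' - \<alpha> \<cdot>\<^sub>v p;
            \<beta>' = vec_norm2 z;
            p' = (1 / \<beta>') \<cdot>\<^sub>v z
        in (\<alpha>, q', \<beta>', p'))"

definition lanczos_alpha :: "real mat \<Rightarrow> real vec \<Rightarrow> nat \<Rightarrow> real" where
  "lanczos_alpha A b j = (case lanczos A b j of (\<alpha>, q, \<beta>, p) \<Rightarrow> \<alpha>)"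

definition lanczos_q :: "real mat \<Rightarrow> real vec \<Rightarrow> nat \<Rightarrow> real vec" where
  "lanczos_q A b j = (case lanczos A b j of (\<alpha>, q, \<beta>, p) \<Rightarrow> q)"

definition lanczos_beta :: "real mat \<Rightarrow> real vec \<Rightarrow> nat \<Rightarrow> real" where
  "lanczos_beta A b j = (case lanczos A b (j - 1) of (\<alpha>, q, \<beta>, p) \<Rightarrow> \<beta>)"

definition lanczos_p :: "real mat \<Rightarrow> real vec \<Rightarrow> nat \<Rightarrow> real vec" where
  "lanczos_p A b j = (case lanczos A b (j - 1) of (\<alpha>, q, \<beta>, p) \<Rightarrow> p)"

lemma lanczos_start:
  "lanczos_p A b 1 = (1 / vec_norm2 b) \<cdot>\<^sub>v b"
  "lanczos_q A b 0 = 0\<^sub>v (dim_col A)"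
  by (simp_all add: lanczos_p_def lanczos_q_def)

lemma lanczos_step:
  fixes A :: "real mat" and b :: "real vec"
  assumes "j \<ge> 1"
  defines "r \<equiv> transpose_mat A *\<^sub>v lanczos_p A b j - lanczos_beta A b j \<cdot>\<^sub>v lanczos_q A b (j - 1)"
    and "z \<equiv> A *\<^sub>v lanczos_q A b j - lanczos_alpha A b j \<cdot>\<^sub>v lanczos_p A b j"
  shows "lanczos_alpha A b j = vec_norm2 r"
    and "lanczos_q A b j = (1 / lanczos_alpha A b j) \<cdot>\<^sub>v r"
    and "lanczos_beta A b (j + 1) = vec_norm2 z"
    and "lanczos_p A b (j + 1) = (1 / lanczos_beta A b (j + 1)) \<cdot>\<^sub>v z"
proof -
  obtain i where j: "j = Suc i"
    using assms(1) by (cases j) auto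
  obtain a q t p where s: "lanczos A b i = (a, q, t, p)"
    by (cases "lanczos A b i") auto
  show "lanczos_alpha A b j = vec_norm2 r"
    and "lanczos_q A b j = (1 / lanczos_alpha A b j) \<cdot>\<^sub>v r"
    and "lanczos_beta A b (j + 1) = vec_norm2 z"
    and "lanczos_p A b (j + 1) = (1 / lanczos_beta A b (j + 1)) \<cdot>\<^sub>v z"
    unfolding r_def z_def j lanczos_alpha_def lanczos_q_def lanczos_beta_def lanczos_p_def
    by (simp_all add: s Let_def)
qed

definition lanczos_P :: "real mat \<Rightarrow> real vec \<Rightarrow> nat \<Rightarrow> real mat" where
  "lanczos_P A b k = mat_of_cols (dim_row A) (map (lanczos_p A b) [1..<k + 1])"

definition lanczos_Q :: "real mat \<Rightarrow> real vec \<Rightarrow> nat \<Rightarrow> real mat" where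
  "lanczos_Q A b k = mat_of_cols (dim_col A) (map (lanczos_q A b) [1..<k + 1])"

definition lanczos_B :: "real mat \<Rightarrow> real vec \<Rightarrow> nat \<Rightarrow> real mat" where
  "lanczos_B A b k = transpose_mat (lanczos_P A b (k + 1)) * A * lanczos_Q A b k"

definition lanczos_gamma :: "real mat \<Rightarrow> real vec \<Rightarrow> nat \<Rightarrow> real" where
  "lanczos_gamma A b k =
     mat_norm2 (A - lanczos_P A b (k + 1) * lanczos_B A b k * transpose_mat (lanczos_Q A b k))"


text \<open>\<open>mat_inverse\<close> returns an option.  Below it is only meant to be applied to nonsingular
  matrices: \<open>Tk1\<close> is Vandermonde with nodes $\sigma_i^2$ and \<open>D1\<close> is diagonal with entries
  $\sigma_i u_i^T b \neq 0$.\<close>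

abbreviation mat_inv :: "real mat \<Rightarrow> real mat" where
  "mat_inv M \<equiv> the (mat_inverse M)"

definition krylov_D :: "nat \<Rightarrow> real mat \<Rightarrow> (nat \<Rightarrow> real) \<Rightarrow> real vec \<Rightarrow> real mat" where
  "krylov_D n U \<sigma> b = mat_diag n (\<lambda>i. \<sigma> (Suc i) * (col U i \<bullet> b))"

definition krylov_T :: "nat \<Rightarrow> (nat \<Rightarrow> real) \<Rightarrow> nat \<Rightarrow> real mat" where
  "krylov_T n \<sigma> k = mat n k (\<lambda>(i, j). \<sigma> (Suc i) ^ (2 * j))"

definition krylov_Delta ::
  "nat \<Rightarrow> real mat \<Rightarrow> (nat \<Rightarrow> real) \<Rightarrow> real vec \<Rightarrow> nat \<Rightarrow> real mat" where
  "krylov_Delta n U \<sigma> b k =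
     (case split_block (krylov_D n U \<sigma> b) k k of (D1, _, _, D2) \<Rightarrow>
      case split_block (krylov_T n \<sigma> k) k k of (Tk1, _, Tk2, _) \<Rightarrow>
        D2 * Tk2 * mat_inv Tk1 * mat_inv D1)"

definition eta_rhs :: "nat \<Rightarrow> real mat \<Rightarrow> (nat \<Rightarrow> real) \<Rightarrow> real vec \<Rightarrow> nat \<Rightarrow> real" where
  "eta_rhs n U \<sigma> b k =
     (let S = mat_diag k (\<lambda>i. \<sigma> (Suc i));
          \<Delta> = krylov_Delta n U \<sigma> b k;
          \<Delta>T = transpose_mat \<Delta>;
          J = mat_inv (1\<^sub>m k + \<Delta>T * \<Delta>)
      in (mat_norm2 (S * J * (\<Delta>T * \<Delta>)))\<^sup>2 + (mat_norm2 (S * J * \<Delta>T))\<^sup>2)"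

definition eta :: "nat \<Rightarrow> real mat \<Rightarrow> (nat \<Rightarrow> real) \<Rightarrow> real vec \<Rightarrow> nat \<Rightarrow> real" where
  "eta n U \<sigma> b k = sqrt (eta_rhs n U \<sigma> b k) / \<sigma> (k + 1)"

lemma eta_unique:
  assumes "\<sigma> (k + 1) > 0"
  shows "x = eta n U \<sigma> b k \<longleftrightarrow> x \<ge> 0 \<and> x\<^sup>2 * (\<sigma> (k + 1))\<^sup>2 = eta_rhs n U \<sigma> b k"
proof -
  have nonneg: "eta_rhs n U \<sigma> b k \<ge> 0"
    by (simp add: eta_rhs_def Let_def)
  have "x = eta n U \<sigma> b k \<longleftrightarrow> x * \<sigma> (k + 1) = sqrt (eta_rhs n U \<sigma> b k)"
    using assms by (auto simp: eta_def field_simps)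
  also have "\<dots> \<longleftrightarrow> x * \<sigma> (k + 1) \<ge> 0 \<and> (x * \<sigma> (k + 1))\<^sup>2 = eta_rhs n U \<sigma> b k"
    using nonneg by (metis real_sqrt_ge_zero real_sqrt_pow2 real_sqrt_unique)
  also have "\<dots> \<longleftrightarrow> x \<ge> 0 \<and> x\<^sup>2 * (\<sigma> (k + 1))\<^sup>2 = eta_rhs n U \<sigma> b k"
    using assms by (simp add: power_mult_distrib zero_le_mult_iff)
  finally show ?thesis .
qed

end

theory Submission
  imports Defs "Jordan_Normal_Form.Determinant"
begin

text \<open>Since $A Q_k = P_{k+1} B_k$, the residual $A - P_{k+1} B_k Q_k^T$ equals $A(I - Q_k Q_k^T)$: it is
  \<open>A\<close> applied after projecting away the first \<open>k\<close> right Lanczos vectors.  Each claim estimates the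
  norm of this product (\<open>residual_mult\<close>).

  Lower bounds.  The vector $q_{k+1}$ survives the projection and
  $A q_{k+1} = \alpha_{k+1} p_{k+1} + \beta_{k+2} p_{k+2}$ with orthonormal $p_{k+1}, p_{k+2}$, so
  $\alpha_{k+1}^2 + \beta_{k+2}^2 \<le> \gamma_k^2$ (\<open>gamma_lower\<close>).  Both entries are positive, so
  each is strictly below $\gamma_k$, and the bound on their product is the inequality between the
  arithmetic and the geometric mean.

  Strict decrease.  A vector at which the norm of the residual of index $k+1$ is attained
  (\<open>mat_norm2_attained\<close>) can be taken orthogonal to $q_1,\dots,q_{k+1}$.  If
  $\gamma_k \<le> \gamma_{k+1}$, it also maximises the residual of index \<open>k\<close>, hence is a singular vector
  of it.  On the span of $q_{k+1},\dots,q_n$ the singular vector equation is a three-term recurrence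
  with nonzero off-diagonal coefficients; a solution whose first coordinate vanishes is zero
  (\<open>gamma_decreasing\<close>).

  Upper bound.  The span of $q_1,\dots,q_k$ is the Krylov space of $A^T A$ and $A^T b$.  In the basis of
  right singular vectors its elements have the coordinates
  $\sigma_i (u_i^T b)\, h(\sigma_i^2)$ with $\deg h < k$ (\<open>lanczos_vectors_poly\<close>), so the space is the
  graph of $\Delta_k$ over the first \<open>k\<close> coordinates (\<open>coords_on_graph\<close>, \<open>coords_first_surjective\<close>).
  The first \<open>k\<close> coordinates of the projection onto the orthogonal complement of a graph have the
  closed form of \<open>graph_complement_component\<close>, and multiplying them by $\Sigma_k$ gives the two matrices
  in the definition of $\eta_k$.  The other coordinates are multiplied by singular values
  that are at most $\sigma_{k+1}$, and projecting does not increase the norm (\<open>gamma_sq_upper\<close>).\<close>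

section \<open>Euclidean and spectral norm\<close>

lemma vec_norm2_nonneg: "vec_norm2 v \<ge> 0"
  by (simp add: vec_norm2_def scalar_prod_def sum_nonneg)

lemma vec_norm2_sq: "(vec_norm2 v)\<^sup>2 = v \<bullet> v"
  by (simp add: vec_norm2_def scalar_prod_def sum_nonneg)

lemma scalar_prod_self_nonneg: "(v :: real Matrix.vec) \<bullet> v \<ge> 0"
  by (simp add: scalar_prod_def sum_nonneg)

lemma scalar_prod_self_eq_0:
  assumes "(v :: real Matrix.vec) \<in> carrier_vec n" "v \<bullet> v = 0"
  shows "v = 0\<^sub>v n"
proof -
  have "\<And>i. i < dim_vec v \<Longrightarrow> v $ i = 0"
    using assms(2) by (auto simp: scalar_prod_def sum_nonneg_eq_0_iff)
  then show ?thesis using assms(1) by auto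
qed

lemma scalar_prod_self_pos:
  assumes "(v :: real Matrix.vec) \<in> carrier_vec n" "v \<noteq> 0\<^sub>v n"
  shows "v \<bullet> v > 0"
  using assms scalar_prod_self_eq_0[OF assms(1)] scalar_prod_self_nonneg[of v] by (auto simp: less_le)

lemma scalar_prod_adjoint:
  assumes "(M :: real mat) \<in> carrier_mat r c" "x \<in> carrier_vec c" "y \<in> carrier_vec r"
  shows "(M *\<^sub>v x) \<bullet> y = x \<bullet> (transpose_mat M *\<^sub>v y)"
  using assms transpose_vec_mult_scalar[OF assms]
  by (metis comm_scalar_prod mult_mat_vec_carrier transpose_carrier_mat)

lemma discriminant_bound:
  fixes a b c :: real
  assumes "c \<ge> 0" "\<And>t. a - 2 * t * b + t\<^sup>2 * c \<ge> 0"
  shows "b\<^sup>2 \<le> a * c"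
proof (cases "c = 0")
  case True
  have "b = 0"
  proof (rule ccontr)
    assume "b \<noteq> 0"
    then show False using assms(2)[of "(a + 1) / (2 * b)"] True by (simp add: field_simps)
  qed
  then show ?thesis using True by simp
next
  case False
  then have "c > 0" using assms(1) by simp
  have "0 \<le> (a - 2 * (b / c) * b + (b / c)\<^sup>2 * c) * c"
    using assms(2)[of "b / c"] \<open>c > 0\<close> by simp
  also have "\<dots> = a * c - b\<^sup>2"
    using \<open>c > 0\<close> by (simp add: field_simps power2_eq_square)
  finally show ?thesis by simp
qed

lemma scalar_prod_diff_self:
  assumes x: "(x :: real Matrix.vec) \<in> carrier_vec n" and y: "y \<in> carrier_vec n"
  shows "(x - t \<cdot>\<^sub>v y) \<bullet> (x - t \<cdot>\<^sub>v y) = x \<bullet> x - 2 * t * (x \<bullet> y) + t\<^sup>2 * (y \<bullet> y)"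
proof -
  define z where "z = t \<cdot>\<^sub>v y"
  have z: "z \<in> carrier_vec n" using y by (simp add: z_def)
  have "(x - z) \<bullet> (x - z) = x \<bullet> x - z \<bullet> x - (x \<bullet> z - z \<bullet> z)"
    using x z by (simp add: minus_scalar_prod_distrib[of _ n] scalar_prod_minus_distrib[of _ n])
  moreover have "x \<bullet> z = t * (x \<bullet> y)" "z \<bullet> x = t * (x \<bullet> y)" "z \<bullet> z = t\<^sup>2 * (y \<bullet> y)"
    using x y comm_scalar_prod[OF x y] by (simp_all add: z_def power2_eq_square)
  ultimately show ?thesis by (simp add: z_def)
qed

lemma scalar_prod_Cauchy_Schwarz:
  assumes "(x :: real Matrix.vec) \<in> carrier_vec n" "y \<in> carrier_vec n"
  shows "(x \<bullet> y)\<^sup>2 \<le> (x \<bullet> x) * (y \<bullet> y)"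
  by (rule discriminant_bound)
     (use scalar_prod_diff_self[OF assms] scalar_prod_self_nonneg in \<open>metis\<close>)+

lemma vec_norm2_mult_le_Frobenius:
  assumes "(M :: real mat) \<in> carrier_mat r c" "x \<in> carrier_vec c"
  shows "vec_norm2 (M *\<^sub>v x) \<le> sqrt (\<Sum>i<r. row M i \<bullet> row M i) * vec_norm2 x"
proof -
  have "(M *\<^sub>v x) \<bullet> (M *\<^sub>v x) = (\<Sum>i<r. (row M i \<bullet> x)\<^sup>2)"
    using assms by (simp add: scalar_prod_def[of "M *\<^sub>v x"] power2_eq_square atLeast0LessThan)
  also have "\<dots> \<le> (\<Sum>i<r. (row M i \<bullet> row M i) * (x \<bullet> x))"
    using assms by (intro sum_mono scalar_prod_Cauchy_Schwarz[of _ c]) auto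
  also have "\<dots> = (\<Sum>i<r. row M i \<bullet> row M i) * (x \<bullet> x)"
    by (simp add: sum_distrib_right)
  finally show ?thesis
    unfolding vec_norm2_def by (metis real_sqrt_le_mono real_sqrt_mult)
qed

lemma vec_norm2_eq_0:
  assumes "x \<in> carrier_vec n"
  shows "vec_norm2 x = 0 \<longleftrightarrow> x = 0\<^sub>v n"
  using assms scalar_prod_self_eq_0[OF assms] by (auto simp: vec_norm2_def)

lemma mat_norm2_bdd_above:
  "bdd_above ((\<lambda>x. vec_norm2 (M *\<^sub>v x) / vec_norm2 x) ` carrier_vec (dim_col M))"
proof (rule bdd_aboveI2)
  fix x :: "real Matrix.vec" assume x: "x \<in> carrier_vec (dim_col M)"
  show "vec_norm2 (M *\<^sub>v x) / vec_norm2 x \<le> sqrt (\<Sum>i<dim_row M. row M i \<bullet> row M i)"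
  proof (cases "vec_norm2 x = 0")
    case True
    then show ?thesis by (simp add: sum_nonneg scalar_prod_self_nonneg)
  next
    case False
    then have "vec_norm2 x > 0" using vec_norm2_nonneg[of x] by simp
    then show ?thesis
      using vec_norm2_mult_le_Frobenius[of M "dim_row M" "dim_col M" x] x
      by (simp add: pos_divide_le_eq)
  qed
qed

lemma vec_norm2_mult_le:
  assumes "M \<in> carrier_mat r c" "x \<in> carrier_vec c"
  shows "vec_norm2 (M *\<^sub>v x) \<le> mat_norm2 M * vec_norm2 x"
proof (cases "x = 0\<^sub>v c")
  case True
  then have "M *\<^sub>v x = 0\<^sub>v r" using assms by auto
  then show ?thesis using True by (simp add: vec_norm2_def)
next
  case False
  then have pos: "vec_norm2 x > 0"
    using vec_norm2_eq_0[OF assms(2)] vec_norm2_nonneg[of x] by simp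
  have "vec_norm2 (M *\<^sub>v x) / vec_norm2 x \<le> mat_norm2 M"
    unfolding mat_norm2_def by (rule cSUP_upper[OF _ mat_norm2_bdd_above]) (use assms in auto)
  then show ?thesis using pos by (simp add: pos_divide_le_eq)
qed

lemma mat_norm2_nonneg: "mat_norm2 M \<ge> 0"
proof -
  have "vec_norm2 (M *\<^sub>v 0\<^sub>v (dim_col M)) / vec_norm2 (0\<^sub>v (dim_col M)) \<le> mat_norm2 M"
    unfolding mat_norm2_def by (rule cSUP_upper[OF _ mat_norm2_bdd_above]) auto
  then show ?thesis by (simp add: vec_norm2_def)
qed

lemma mat_norm2_le:
  assumes "M \<in> carrier_mat r c" "C \<ge> 0"
    and "\<And>x. x \<in> carrier_vec c \<Longrightarrow> vec_norm2 (M *\<^sub>v x) \<le> C * vec_norm2 x"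
  shows "mat_norm2 M \<le> C"
  unfolding mat_norm2_def
proof (rule cSUP_least)
  fix x :: "real Matrix.vec" assume "x \<in> carrier_vec (dim_col M)"
  then have x: "x \<in> carrier_vec c" using assms(1) by simp
  show "vec_norm2 (M *\<^sub>v x) / vec_norm2 x \<le> C"
    using assms(3)[OF x] assms(2) vec_norm2_nonneg[of x]
    by (cases "vec_norm2 x = 0") (auto simp: divide_le_eq)
next
  show "carrier_vec (dim_col M) \<noteq> ({} :: real Matrix.vec set)"
    by (metis empty_iff zero_carrier_vec)
qed

lemma mult_self_le_mat_norm2:
  assumes "M \<in> carrier_mat r c" "x \<in> carrier_vec c"
  shows "(M *\<^sub>v x) \<bullet> (M *\<^sub>v x) \<le> (mat_norm2 M)\<^sup>2 * (x \<bullet> x)"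
  using power_mono[OF vec_norm2_mult_le[OF assms] vec_norm2_nonneg, of 2]
  by (simp add: power_mult_distrib vec_norm2_sq)

lemma mat_norm2_sq_le:
  assumes "M \<in> carrier_mat r c" "C \<ge> 0"
    and "\<And>x. x \<in> carrier_vec c \<Longrightarrow> (M *\<^sub>v x) \<bullet> (M *\<^sub>v x) \<le> C * (x \<bullet> x)"
  shows "(mat_norm2 M)\<^sup>2 \<le> C"
proof -
  have "mat_norm2 M \<le> sqrt C"
  proof (rule mat_norm2_le[OF assms(1)])
    fix x :: "real Matrix.vec" assume "x \<in> carrier_vec c"
    from assms(3)[OF this] show "vec_norm2 (M *\<^sub>v x) \<le> sqrt C * vec_norm2 x"
      unfolding vec_norm2_def by (metis real_sqrt_le_mono real_sqrt_mult)
  qed (use assms(2) in simp)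
  then show ?thesis
    using power_mono[OF _ mat_norm2_nonneg, of M "sqrt C" 2] assms(2) by simp
qed

text \<open>The form $\|M\|^2 x^T y - (Mx)^T(My)$ is positive semidefinite, so it obeys its own Cauchy-Schwarz
  inequality.  Both the attainment of the norm and the singular vector equation for a maximiser
  come from it, without compactness or diagonalisation.\<close>

lemma norm_defect_Cauchy_Schwarz:
  assumes M: "M \<in> carrier_mat r c" and x: "x \<in> carrier_vec c" and y: "y \<in> carrier_vec c"
  defines "g \<equiv> (mat_norm2 M)\<^sup>2"
  shows "(g * (x \<bullet> y) - (M *\<^sub>v x) \<bullet> (M *\<^sub>v y))\<^sup>2
       \<le> (g * (x \<bullet> x) - (M *\<^sub>v x) \<bullet> (M *\<^sub>v x)) * (g * (y \<bullet> y) - (M *\<^sub>v y) \<bullet> (M *\<^sub>v y))"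
proof (rule discriminant_bound)
  show "0 \<le> g * (y \<bullet> y) - (M *\<^sub>v y) \<bullet> (M *\<^sub>v y)"
    using mult_self_le_mat_norm2[OF M y] by (simp add: g_def)
  fix t :: real
  have dist: "M *\<^sub>v (x - t \<cdot>\<^sub>v y) = M *\<^sub>v x - t \<cdot>\<^sub>v (M *\<^sub>v y)"
    using M x y by (simp add: mult_minus_distrib_mat_vec[of _ r c] mult_mat_vec[of _ r c])
  have "(M *\<^sub>v (x - t \<cdot>\<^sub>v y)) \<bullet> (M *\<^sub>v (x - t \<cdot>\<^sub>v y)) \<le> g * ((x - t \<cdot>\<^sub>v y) \<bullet> (x - t \<cdot>\<^sub>v y))"
    unfolding g_def by (rule mult_self_le_mat_norm2[OF M]) (use x y in auto)
  then show "0 \<le> (g * (x \<bullet> x) - (M *\<^sub>v x) \<bullet> (M *\<^sub>v x))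
        - 2 * t * (g * (x \<bullet> y) - (M *\<^sub>v x) \<bullet> (M *\<^sub>v y))
        + t\<^sup>2 * (g * (y \<bullet> y) - (M *\<^sub>v y) \<bullet> (M *\<^sub>v y))"
    unfolding dist scalar_prod_diff_self[OF x y]
      scalar_prod_diff_self[OF mult_mat_vec_carrier[OF M x] mult_mat_vec_carrier[OF M y]]
    by (simp add: algebra_simps)
qed

text \<open>A maximiser is isotropic for the semidefinite form $\|M\|^2 x^T y - (Mx)^T(My)$, hence lies in its
  kernel.\<close>

lemma norm_maximiser_singular:
  assumes M: "M \<in> carrier_mat r c" and x: "x \<in> carrier_vec c" and y: "y \<in> carrier_vec c"
    and max: "(M *\<^sub>v x) \<bullet> (M *\<^sub>v x) \<ge> (mat_norm2 M)\<^sup>2 * (x \<bullet> x)"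
  shows "(M *\<^sub>v x) \<bullet> (M *\<^sub>v y) = (mat_norm2 M)\<^sup>2 * (x \<bullet> y)"
  using norm_defect_Cauchy_Schwarz[OF M x y] max mult_self_le_mat_norm2[OF M x] by auto

section \<open>Invertible matrices\<close>

lemma injective_obtain_inverse:
  assumes M: "(M :: real mat) \<in> carrier_mat n n"
    and inj: "\<And>x. x \<in> carrier_vec n \<Longrightarrow> M *\<^sub>v x = 0\<^sub>v n \<Longrightarrow> x = 0\<^sub>v n"
  shows "mat_inv M \<in> carrier_mat n n" "M * mat_inv M = 1\<^sub>m n" "mat_inv M * M = 1\<^sub>m n"
proof -
  have "Determinant.det M \<noteq> 0"
    using det_0_iff_vec_prod_zero_field[OF M] inj by blast
  from det_non_zero_imp_unit[OF M this] mat_inverse(1)[OF M]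
  obtain B where "mat_inverse M = Some B" by (metis not_None_eq)
  with mat_inverse(2)[OF M this]
  show "mat_inv M \<in> carrier_mat n n" "M * mat_inv M = 1\<^sub>m n" "mat_inv M * M = 1\<^sub>m n" by auto
qed

lemma left_inverse_imp_injective:
  assumes "(B :: real mat) \<in> carrier_mat n n" "M \<in> carrier_mat n n" "B * M = 1\<^sub>m n"
    "x \<in> carrier_vec n" "M *\<^sub>v x = 0\<^sub>v n"
  shows "x = 0\<^sub>v n"
proof -
  have "x = (B * M) *\<^sub>v x" unfolding assms(3) using assms(4) by simp
  also have "\<dots> = B *\<^sub>v (M *\<^sub>v x)" by (rule assoc_mult_mat_vec) (use assms in auto)
  also have "\<dots> = 0\<^sub>v n" unfolding assms(5) using assms(1) by auto
  finally show ?thesis .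
qed

text \<open>If $N = \|M\|^2 I - M^T M$ were invertible, the Cauchy-Schwarz inequality for the form of \<open>N\<close>,
  applied to \<open>x\<close> and $N^{-1} x$, would bound $x^T N x$ below by a positive multiple of $x^T x$, so that
  the supremum $\|M\|$ could be lowered.  So \<open>N\<close> has a kernel, and its nonzero vectors are maximisers.\<close>

lemma mat_norm2_attained:
  assumes M: "M \<in> carrier_mat r n" and n: "n > 0"
  obtains x where "x \<in> carrier_vec n" "x \<noteq> 0\<^sub>v n"
    "(M *\<^sub>v x) \<bullet> (M *\<^sub>v x) = (mat_norm2 M)\<^sup>2 * (x \<bullet> x)"
proof -
  have smult_mat_mult_vec: "(g \<cdot>\<^sub>m 1\<^sub>m n) *\<^sub>v y = g \<cdot>\<^sub>v y" if "y \<in> carrier_vec n"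
    for g :: real and y
    using that by (intro eq_vecI) auto
  define g where "g = (mat_norm2 M)\<^sup>2"
  define N where "N = g \<cdot>\<^sub>m 1\<^sub>m n - transpose_mat M * M"
  have N: "N \<in> carrier_mat n n" unfolding N_def using M by (intro minus_carrier_mat) auto
  have Nmult: "N *\<^sub>v y = g \<cdot>\<^sub>v y - transpose_mat M *\<^sub>v (M *\<^sub>v y)" if "y \<in> carrier_vec n" for y
    using that M
    by (simp add: N_def minus_mult_distrib_mat_vec[of _ n n] smult_mat_mult_vec)
  have form: "x \<bullet> (N *\<^sub>v y) = g * (x \<bullet> y) - (M *\<^sub>v x) \<bullet> (M *\<^sub>v y)"
    if "x \<in> carrier_vec n" "y \<in> carrier_vec n" for x y
    using that M
    by (simp add: Nmult scalar_prod_minus_distrib[of _ n] scalar_prod_adjoint[of M r n x])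
  show thesis
  proof (cases "\<exists>x. x \<in> carrier_vec n \<and> x \<noteq> 0\<^sub>v n \<and> N *\<^sub>v x = 0\<^sub>v n")
    case True
    then obtain x where x: "x \<in> carrier_vec n" "x \<noteq> 0\<^sub>v n" "N *\<^sub>v x = 0\<^sub>v n" by blast
    with form[of x x] show thesis by (intro that[of x]) (auto simp: g_def)
  next
    case False
    note inv = injective_obtain_inverse[OF N]
    have B: "mat_inv N \<in> carrier_mat n n" "N * mat_inv N = 1\<^sub>m n" using inv False by blast+
    \<comment> \<open>The summand 1 makes \<open>K\<close> positive, so that it can serve as a divisor.\<close>
    define K where "K = (mat_norm2 (mat_inv N)) + 1"
    have K: "K > 0" using mat_norm2_nonneg[of "mat_inv N"] by (simp add: K_def)
    have key: "(M *\<^sub>v x) \<bullet> (M *\<^sub>v x) \<le> (g - 1 / K) * (x \<bullet> x)" if x: "x \<in> carrier_vec n" for x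
    proof (cases "x \<bullet> x = 0")
      case True
      then show ?thesis using mult_self_le_mat_norm2[OF M x] by simp
    next
      case False
      then have xx: "x \<bullet> x > 0" using scalar_prod_self_nonneg[of x] by simp
      define y where "y = mat_inv N *\<^sub>v x"
      have y: "y \<in> carrier_vec n" using B x by (simp add: y_def)
      have Ny: "N *\<^sub>v y = x" using B N x by (simp add: y_def assoc_mult_mat_vec[of _ n n _ n, symmetric])
      have "(x \<bullet> x)\<^sup>2 \<le> (x \<bullet> (N *\<^sub>v x)) * (y \<bullet> x)"
        using norm_defect_Cauchy_Schwarz[OF M x y, folded g_def] form[OF x y] form[OF y y]
          form[OF x x] by (simp add: Ny)
      also have "\<dots> \<le> (x \<bullet> (N *\<^sub>v x)) * (K * (x \<bullet> x))"
      proof (rule mult_left_mono)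
        have "(y \<bullet> x)\<^sup>2 \<le> (y \<bullet> y) * (x \<bullet> x)" by (rule scalar_prod_Cauchy_Schwarz[OF y x])
        also have "\<dots> \<le> ((K - 1)\<^sup>2 * (x \<bullet> x)) * (x \<bullet> x)"
          using mult_self_le_mat_norm2[OF B(1) x] xx by (simp add: K_def y_def)
        also have "\<dots> = ((K - 1) * (x \<bullet> x))\<^sup>2" by (simp add: power2_eq_square algebra_simps)
        finally have "y \<bullet> x \<le> (K - 1) * (x \<bullet> x)"
          using K mat_norm2_nonneg[of "mat_inv N"] xx power2_le_imp_le[of "y \<bullet> x"]
          by (simp add: K_def)
        then show "y \<bullet> x \<le> K * (x \<bullet> x)" using xx by (simp add: algebra_simps)
        show "0 \<le> x \<bullet> (N *\<^sub>v x)"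
          using form[OF x x] mult_self_le_mat_norm2[OF M x] by (simp add: g_def)
      qed
      finally have "x \<bullet> x \<le> (x \<bullet> (N *\<^sub>v x)) * K"
        using xx by (simp add: power2_eq_square mult.assoc[symmetric])
      then show ?thesis using K form[OF x x] by (simp add: field_simps)
    qed
    have "0 \<le> g - 1 / K"
    proof -
      have u: "unit_vec n 0 \<in> carrier_vec n" by simp
      have "unit_vec n 0 \<bullet> unit_vec n 0 = (1 :: real)" using n by simp
      then show ?thesis
        using key[OF u] scalar_prod_self_nonneg[of "M *\<^sub>v unit_vec n 0"] by simp
    qed
    from mat_norm2_sq_le[OF M this key] K have False by (simp add: g_def)
    then show thesis ..
  qed
qed

section \<open>Matrices with orthonormal columns\<close>

definition orth_residual :: "real mat \<Rightarrow> real Matrix.vec \<Rightarrow> real Matrix.vec" where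
  "orth_residual Q x = x - Q *\<^sub>v (transpose_mat Q *\<^sub>v x)"

lemma orth_residual_carrier:
  assumes "Q \<in> carrier_mat n k" "x \<in> carrier_vec n"
  shows "orth_residual Q x \<in> carrier_vec n"
  using assms unfolding orth_residual_def by (intro minus_carrier_vec mult_mat_vec_carrier) auto

lemma transpose_mult_orth_residual:
  assumes Q: "Q \<in> carrier_mat n k" and orth: "transpose_mat Q * Q = 1\<^sub>m k"
    and x: "x \<in> carrier_vec n"
  shows "transpose_mat Q *\<^sub>v orth_residual Q x = 0\<^sub>v k"
proof -
  have Qt: "transpose_mat Q \<in> carrier_mat k n" using Q by simp
  define g where "g = transpose_mat Q *\<^sub>v x"
  have g: "g \<in> carrier_vec k" using Qt x by (simp add: g_def)
  have "transpose_mat Q *\<^sub>v (Q *\<^sub>v g) = g"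
    using g by (simp add: assoc_mult_mat_vec[OF Qt Q g, symmetric] orth)
  then show ?thesis
    unfolding orth_residual_def g_def[symmetric]
    using mult_minus_distrib_mat_vec[OF Qt x, of "Q *\<^sub>v g"] Q g by (simp add: g_def[symmetric])
qed

lemma orth_residual_self_le:
  assumes Q: "Q \<in> carrier_mat n k" and orth: "transpose_mat Q * Q = 1\<^sub>m k"
    and x: "x \<in> carrier_vec n"
  shows "orth_residual Q x \<bullet> orth_residual Q x \<le> x \<bullet> x"
proof -
  have Qt: "transpose_mat Q \<in> carrier_mat k n" using Q by simp
  define g where "g = transpose_mat Q *\<^sub>v x"
  have g: "g \<in> carrier_vec k" using Qt x by (simp add: g_def)
  have Qg: "Q *\<^sub>v g \<in> carrier_vec n" using Q g by simp
  have "(Q *\<^sub>v g) \<bullet> (Q *\<^sub>v g) = g \<bullet> g"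
    using g by (simp add: scalar_prod_adjoint[OF Q g Qg] assoc_mult_mat_vec[OF Qt Q g, symmetric] orth)
  moreover have "x \<bullet> (Q *\<^sub>v g) = g \<bullet> g"
    using scalar_prod_adjoint[OF Q g x] comm_scalar_prod[OF x Qg] by (simp add: g_def)
  ultimately have "orth_residual Q x \<bullet> orth_residual Q x = x \<bullet> x - g \<bullet> g"
    using scalar_prod_diff_self[OF x Qg, of 1] by (simp add: orth_residual_def g_def[symmetric])
  then show ?thesis using scalar_prod_self_nonneg[of g] by simp
qed

lemma orth_residual_of_orthogonal:
  assumes Q: "Q \<in> carrier_mat n k" and x: "x \<in> carrier_vec n"
    and "transpose_mat Q *\<^sub>v x = 0\<^sub>v k"
  shows "orth_residual Q x = x"
  using assms by (auto simp: orth_residual_def)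

section \<open>The Lanczos vectors\<close>

text \<open>The starting vector is nonzero so that $p_1$ is a unit vector; positivity of the coefficients
  excludes breakdown.\<close>

locale lanczos_run =
  fixes A :: "real mat" and b :: "real Matrix.vec" and m n :: nat
  assumes A: "A \<in> carrier_mat m n" and b: "b \<in> carrier_vec m" and b_nz: "b \<noteq> 0\<^sub>v m"
    and positive: "\<And>i. i \<in> {1..n} \<Longrightarrow> lanczos_alpha A b i > 0 \<and> lanczos_beta A b (i + 1) > 0"
begin

abbreviation "\<alpha> \<equiv> lanczos_alpha A b"
abbreviation "\<beta> \<equiv> lanczos_beta A b"
abbreviation "p \<equiv> lanczos_p A b"
abbreviation "q \<equiv> lanczos_q A b"
abbreviation "P \<equiv> lanczos_P A b"
abbreviation "Q \<equiv> lanczos_Q A b"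

lemma At: "transpose_mat A \<in> carrier_mat n m"
  using A by simp

lemma lanczos_carrier:
  "case lanczos A b j of (_, q', _, p') \<Rightarrow> q' \<in> carrier_vec n \<and> p' \<in> carrier_vec m"
proof (induction j)
  case 0
  then show ?case using A b by simp
next
  case (Suc j)
  obtain a' q' t' p' where "lanczos A b j = (a', q', t', p')"
    by (cases "lanczos A b j") auto
  with Suc A show ?case
    by (auto simp: Let_def intro!: mult_mat_vec_carrier[of _ _ m] mult_mat_vec_carrier[of _ _ n])
qed

lemma q_carrier: "q j \<in> carrier_vec n"
  using lanczos_carrier[of j] by (auto simp: lanczos_q_def split: prod.splits)

lemma p_carrier: "p j \<in> carrier_vec m"
  using lanczos_carrier[of "j - 1"] by (auto simp: lanczos_p_def split: prod.splits)

lemma normalized: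
  assumes "x \<in> carrier_vec d" "vec_norm2 x > 0"
  shows "((1 / vec_norm2 x) \<cdot>\<^sub>v x) \<bullet> ((1 / vec_norm2 x) \<cdot>\<^sub>v x) = 1"
proof -
  have "x \<bullet> x = vec_norm2 x * vec_norm2 x" using vec_norm2_sq[of x] by (simp add: power2_eq_square)
  then show ?thesis using assms by simp
qed

lemma scalar_prod_A_q:
  assumes "j \<in> {1..n}" "w \<in> carrier_vec m"
  shows "w \<bullet> (A *\<^sub>v q j) = \<alpha> j * (w \<bullet> p j) + \<beta> (j + 1) * (w \<bullet> p (j + 1))"
proof -
  define z where "z = A *\<^sub>v q j - \<alpha> j \<cdot>\<^sub>v p j"
  have z: "z \<in> carrier_vec m" using A q_carrier p_carrier by (simp add: z_def)
  have "w \<bullet> p (j + 1) = (1 / \<beta> (j + 1)) * (w \<bullet> z)"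
    using lanczos_step(4)[of j A b] assms z by (simp add: z_def)
  moreover have "w \<bullet> z = w \<bullet> (A *\<^sub>v q j) - \<alpha> j * (w \<bullet> p j)"
    using assms(2) A q_carrier[of j] p_carrier[of j]
    by (simp add: z_def scalar_prod_minus_distrib[of _ m])
  ultimately show ?thesis using positive[OF assms(1)] by simp
qed

lemma scalar_prod_At_p:
  assumes "j \<in> {1..n}" "w \<in> carrier_vec n"
  shows "w \<bullet> (transpose_mat A *\<^sub>v p j) = \<alpha> j * (w \<bullet> q j) + \<beta> j * (w \<bullet> q (j - 1))"
proof -
  define r where "r = transpose_mat A *\<^sub>v p j - \<beta> j \<cdot>\<^sub>v q (j - 1)"
  have r: "r \<in> carrier_vec n" using A q_carrier p_carrier by (simp add: r_def)
  have "w \<bullet> q j = (1 / \<alpha> j) * (w \<bullet> r)"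
    using lanczos_step(2)[of j A b] assms r by (simp add: r_def)
  moreover have "w \<bullet> r = w \<bullet> (transpose_mat A *\<^sub>v p j) - \<beta> j * (w \<bullet> q (j - 1))"
    using assms(2) A q_carrier[of "j - 1"] p_carrier[of j]
    by (simp add: r_def scalar_prod_minus_distrib[of _ n])
  ultimately show ?thesis using positive[OF assms(1)] by simp
qed

lemma A_q:
  assumes "j \<in> {1..n}"
  shows "A *\<^sub>v q j = \<alpha> j \<cdot>\<^sub>v p j + \<beta> (j + 1) \<cdot>\<^sub>v p (j + 1)"
proof (rule eq_vecI)
  fix i assume "i < dim_vec (\<alpha> j \<cdot>\<^sub>v p j + \<beta> (j + 1) \<cdot>\<^sub>v p (j + 1))"
  then have i: "i < m" using p_carrier[of "j + 1"] by simp
  have c: "A *\<^sub>v q j \<in> carrier_vec m" using A q_carrier by simp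
  show "(A *\<^sub>v q j) $ i = (\<alpha> j \<cdot>\<^sub>v p j + \<beta> (j + 1) \<cdot>\<^sub>v p (j + 1)) $ i"
    using scalar_prod_A_q[OF assms, of "unit_vec m i"] i c
      p_carrier[of j] p_carrier[of "j + 1"] by simp
qed (use A p_carrier[of "j + 1"] in simp)

lemma beta_1: "\<beta> 1 = 0"
  by (simp add: lanczos_beta_def)

lemma p_1_unit: "p 1 \<bullet> p 1 = 1"
proof -
  have "vec_norm2 b > 0"
    using vec_norm2_eq_0[OF b] b_nz vec_norm2_nonneg[of b] by simp
  then show ?thesis using normalized[OF b] by (simp only: lanczos_start)
qed

text \<open>Each new vector is orthogonalised explicitly only against its predecessors in the recurrence.  Its
  products with the earlier ones vanish because \<open>A\<close> can be moved to the other side of the product,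
  where the companion recurrence expresses it by vectors that are already orthonormal.\<close>

lemma q_step:
  assumes s: "s \<in> {1..n}"
    and p: "p s \<bullet> p s = 1" "\<And>i. i \<in> {1..<s} \<Longrightarrow> p i \<bullet> p s = 0"
    and q: "s > 1 \<Longrightarrow> q (s - 1) \<bullet> q (s - 1) = 1"
      "\<And>i. i \<in> {1..<s - 1} \<Longrightarrow> q i \<bullet> q (s - 1) = 0"
  shows "q s \<bullet> q s = 1" "\<And>i. i \<in> {1..<s} \<Longrightarrow> q i \<bullet> q s = 0"
proof -
  show "q s \<bullet> q s = 1"
  proof -
    define r where "r = transpose_mat A *\<^sub>v p s - \<beta> s \<cdot>\<^sub>v q (s - 1)"
    have r: "r \<in> carrier_vec n" using A q_carrier p_carrier by (simp add: r_def)
    have "\<alpha> s = vec_norm2 r" "q s = (1 / \<alpha> s) \<cdot>\<^sub>v r"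
      using lanczos_step(1,2)[of s A b] s by (simp_all add: r_def)
    then show ?thesis using normalized[OF r] positive[OF s] by metis
  qed
  fix i assume i: "i \<in> {1..<s}"
  then have i': "i \<in> {1..n}" using s by auto
  have Aq: "A *\<^sub>v q i \<in> carrier_vec m" using A q_carrier by simp
  have "q i \<bullet> (transpose_mat A *\<^sub>v p s) = p s \<bullet> (A *\<^sub>v q i)"
    using scalar_prod_adjoint[OF A q_carrier p_carrier, of i s]
      comm_scalar_prod[OF Aq p_carrier, of s] by simp
  also have "\<dots> = \<alpha> i * (p i \<bullet> p s) + \<beta> (i + 1) * (p (i + 1) \<bullet> p s)"
    by (simp add: scalar_prod_A_q[OF i' p_carrier] comm_scalar_prod[OF p_carrier p_carrier, of s])
  also have "\<dots> = (if i + 1 = s then \<beta> s else 0)"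
    using p i by auto
  also have "\<dots> = \<beta> s * (q i \<bullet> q (s - 1))"
    using i q by auto
  finally have "\<alpha> s * (q i \<bullet> q s) = 0"
    using scalar_prod_At_p[OF s q_carrier, of i] by simp
  then show "q i \<bullet> q s = 0" using positive[OF s] by simp
qed

lemma p_step:
  assumes s: "s \<in> {1..n}"
    and p: "p s \<bullet> p s = 1" "\<And>i. i \<in> {1..<s} \<Longrightarrow> p i \<bullet> p s = 0"
    and q: "q s \<bullet> q s = 1" "\<And>i. i \<in> {1..<s} \<Longrightarrow> q i \<bullet> q s = 0"
  shows "p (s + 1) \<bullet> p (s + 1) = 1" "\<And>i. i \<in> {1..<s + 1} \<Longrightarrow> p i \<bullet> p (s + 1) = 0"
proof -
  show "p (s + 1) \<bullet> p (s + 1) = 1"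
  proof -
    define z where "z = A *\<^sub>v q s - \<alpha> s \<cdot>\<^sub>v p s"
    have z: "z \<in> carrier_vec m" using A q_carrier p_carrier by (simp add: z_def)
    have "\<beta> (s + 1) = vec_norm2 z" "p (s + 1) = (1 / \<beta> (s + 1)) \<cdot>\<^sub>v z"
      using lanczos_step(3,4)[of s A b] s by (simp_all add: z_def)
    then show ?thesis using normalized[OF z] positive[OF s] by metis
  qed
  fix i assume i: "i \<in> {1..<s + 1}"
  then have i': "i \<in> {1..n}" using s by auto
  have Atp: "transpose_mat A *\<^sub>v p i \<in> carrier_vec n" using At p_carrier by simp
  have "p i \<bullet> (A *\<^sub>v q s) = q s \<bullet> (transpose_mat A *\<^sub>v p i)"
    using scalar_prod_adjoint[OF A q_carrier p_carrier, of s i]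
      comm_scalar_prod[OF p_carrier mult_mat_vec_carrier[OF A q_carrier], of i s] by simp
  also have "\<dots> = \<alpha> i * (q i \<bullet> q s) + \<beta> i * (q (i - 1) \<bullet> q s)"
    by (simp add: scalar_prod_At_p[OF i' q_carrier] comm_scalar_prod[OF q_carrier q_carrier, of s])
  also have "\<beta> i * (q (i - 1) \<bullet> q s) = 0"
  proof (cases "i = 1")
    case True
    then show ?thesis using beta_1 by simp
  next
    case False
    then have "i - 1 \<in> {1..<s}" using i by auto
    then show ?thesis using q(2) by simp
  qed
  also have "\<alpha> i * (q i \<bullet> q s) + 0 = \<alpha> s * (p i \<bullet> p s)"
    using i p q by (cases "i = s") auto
  finally have "\<beta> (s + 1) * (p i \<bullet> p (s + 1)) = 0"
    using scalar_prod_A_q[OF s p_carrier, of i] by simp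
  then show "p i \<bullet> p (s + 1) = 0" using positive[OF s] by simp
qed

lemma lanczos_orthonormal_upto:
  "s \<le> n \<Longrightarrow> p (s + 1) \<bullet> p (s + 1) = 1 \<and> (\<forall>i\<in>{1..<s + 1}. p i \<bullet> p (s + 1) = 0) \<and>
    (s \<ge> 1 \<longrightarrow> q s \<bullet> q s = 1) \<and> (\<forall>i\<in>{1..<s}. q i \<bullet> q s = 0)"
proof (induction s)
  case 0
  then show ?case using p_1_unit by simp
next
  case (Suc s)
  have s: "Suc s \<in> {1..n}" using Suc.prems by simp
  note IH = Suc.IH[OF Suc_leD[OF Suc.prems]]
  have p: "p (Suc s) \<bullet> p (Suc s) = 1" "\<And>i. i \<in> {1..<Suc s} \<Longrightarrow> p i \<bullet> p (Suc s) = 0"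
    using IH by auto
  have q: "q (Suc s) \<bullet> q (Suc s) = 1" "\<And>i. i \<in> {1..<Suc s} \<Longrightarrow> q i \<bullet> q (Suc s) = 0"
    using q_step[OF s p] IH by auto
  show ?case using p_step[OF s p q] q by auto
qed

lemma q_orthonormal:
  assumes "i \<in> {1..n}" "j \<in> {1..n}"
  shows "q i \<bullet> q j = (if i = j then 1 else 0)"
  using lanczos_orthonormal_upto[of i] lanczos_orthonormal_upto[of j] assms
    comm_scalar_prod[OF q_carrier q_carrier, of i j]
  by (cases i j rule: linorder_cases) auto

lemma p_orthonormal:
  assumes "i \<in> {1..n + 1}" "j \<in> {1..n + 1}"
  shows "p i \<bullet> p j = (if i = j then 1 else 0)"
  using lanczos_orthonormal_upto[of "i - 1"] lanczos_orthonormal_upto[of "j - 1"] assms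
    comm_scalar_prod[OF p_carrier p_carrier, of i j]
  by (cases i j rule: linorder_cases) auto

lemma Q_carrier: "Q k \<in> carrier_mat n k"
  using A by (intro carrier_matI) (simp_all add: lanczos_Q_def del: upt_Suc)

lemma P_carrier: "P k \<in> carrier_mat m k"
  using A by (intro carrier_matI) (simp_all add: lanczos_P_def del: upt_Suc)

lemma col_Q: "j < k \<Longrightarrow> col (Q k) j = q (j + 1)"
  using A q_carrier by (simp add: lanczos_Q_def col_mat_of_cols nth_append del: upt_Suc)

lemma col_P: "j < k \<Longrightarrow> col (P k) j = p (j + 1)"
  using A p_carrier by (simp add: lanczos_P_def col_mat_of_cols nth_append del: upt_Suc)

lemma Q_orthonormal: "k \<le> n \<Longrightarrow> transpose_mat (Q k) * Q k = 1\<^sub>m k"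
  using Q_carrier[of k] by (intro eq_matI) (auto simp: col_Q q_orthonormal)

lemma P_orthonormal: "k \<le> n + 1 \<Longrightarrow> transpose_mat (P k) * P k = 1\<^sub>m k"
  using P_carrier[of k] by (intro eq_matI) (auto simp: col_P p_orthonormal)

lemma Qt_mult_eq_0_iff:
  assumes "w \<in> carrier_vec n"
  shows "transpose_mat (Q k) *\<^sub>v w = 0\<^sub>v k \<longleftrightarrow> (\<forall>i\<in>{1..k}. q i \<bullet> w = 0)"
proof -
  have "transpose_mat (Q k) *\<^sub>v w = 0\<^sub>v k \<longleftrightarrow> (\<forall>j<k. q (j + 1) \<bullet> w = 0)"
    using Q_carrier[of k] by (auto simp: vec_eq_iff col_Q)
  also have "\<dots> \<longleftrightarrow> (\<forall>i\<in>{1..k}. q i \<bullet> w = 0)"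
    by (metis Suc_eq_plus1 Suc_le_eq atLeastAtMost_iff le_add2 le_add_diff_inverse2)
  finally show ?thesis .
qed

lemma PPt_p:
  assumes "k \<le> n + 1" "i \<in> {1..k}"
  shows "P k *\<^sub>v (transpose_mat (P k) *\<^sub>v p i) = p i"
proof -
  define e where "e = (unit_vec k (i - 1) :: real Matrix.vec)"
  have e: "e \<in> carrier_vec k" by (simp add: e_def)
  have Pt: "transpose_mat (P k) \<in> carrier_mat k m" using P_carrier by simp
  have "i - 1 < k" using assms by auto
  then have "P k *\<^sub>v e = col (P k) (i - 1)"
    using P_carrier[of k] by (intro eq_vecI) (auto simp: e_def)
  then have pe: "p i = P k *\<^sub>v e"
    using col_P[of "i - 1" k] assms by auto
  have "transpose_mat (P k) *\<^sub>v (P k *\<^sub>v e) = e"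
    using e by (simp add: assoc_mult_mat_vec[OF Pt P_carrier e, symmetric] P_orthonormal[OF assms(1)])
  then show ?thesis by (simp add: pe)
qed

text \<open>By \<open>A_q\<close> the columns of $A Q_k$ lie in the span of $p_1,\dots,p_{k+1}$, on which
  $P_{k+1} P_{k+1}^T$ is the identity.\<close>

lemma P_B:
  assumes "k \<le> n"
  shows "P (k + 1) * lanczos_B A b k = A * Q k"
proof -
  define R where "R = P (k + 1)"
  have P: "R \<in> carrier_mat m (k + 1)" and Pt: "transpose_mat R \<in> carrier_mat (k + 1) m"
    and Q: "Q k \<in> carrier_mat n k" and AQ: "A * Q k \<in> carrier_mat m k"
    using P_carrier[of "k + 1"] Q_carrier A unfolding R_def by (auto intro: mult_carrier_mat simp del: add_Suc_right)
  have B: "lanczos_B A b k = transpose_mat R * (A * Q k)"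
    unfolding lanczos_B_def R_def[symmetric] by (rule assoc_mult_mat[OF Pt A Q])
  have "R * (transpose_mat R * (A * Q k)) = A * Q k"
  proof (rule mat_col_eqI)
    fix j assume "j < dim_col (A * Q k)"
    then have j: "j < k" using Q by simp
    then have J: "j + 1 \<in> {1..n}" using assms by simp
    have c: "col (A * Q k) j = \<alpha> (j + 1) \<cdot>\<^sub>v p (j + 1) + \<beta> (j + 2) \<cdot>\<^sub>v p (j + 2)"
      using A_q[OF J] col_mult2[OF A Q j] col_Q[OF j] by simp
    have "col (R * (transpose_mat R * (A * Q k))) j
        = R *\<^sub>v (transpose_mat R *\<^sub>v col (A * Q k) j)"
      using col_mult2[OF P mult_carrier_mat[OF Pt AQ] j] col_mult2[OF Pt AQ j] by simp
    also have "\<dots> = \<alpha> (j + 1) \<cdot>\<^sub>v p (j + 1) + \<beta> (j + 2) \<cdot>\<^sub>v p (j + 2)"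
      using P Pt p_carrier[of "j + 1"] p_carrier[of "j + 2"]
        PPt_p[of "k + 1" "j + 1", folded R_def] PPt_p[of "k + 1" "j + 2", folded R_def] j assms
      by (simp add: c mult_add_distrib_mat_vec[OF Pt] mult_add_distrib_mat_vec[OF P]
          mult_mat_vec[OF Pt] mult_mat_vec[OF P])
    finally show "col (R * (transpose_mat R * (A * Q k))) j = col (A * Q k) j"
      using c by simp
  qed (use P AQ in auto)
  then show ?thesis by (simp only: B R_def)
qed

definition residual :: "nat \<Rightarrow> real mat" where
  "residual k = A - P (k + 1) * lanczos_B A b k * transpose_mat (Q k)"

lemma gamma_eq: "lanczos_gamma A b k = mat_norm2 (residual k)"
  by (simp add: lanczos_gamma_def residual_def)

lemma residual_carrier: "residual k \<in> carrier_mat m n"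
  using A P_carrier[of "k + 1"] Q_carrier[of k]
  unfolding residual_def lanczos_B_def by (intro minus_carrier_mat mult_carrier_mat) auto

lemma residual_mult:
  assumes "k \<le> n" "x \<in> carrier_vec n"
  shows "residual k *\<^sub>v x = A *\<^sub>v orth_residual (Q k) x"
proof -
  have Q: "Q k \<in> carrier_mat n k" and Qt: "transpose_mat (Q k) \<in> carrier_mat k n"
    using Q_carrier by auto
  have AQ: "A * Q k \<in> carrier_mat m k" using A Q by (rule mult_carrier_mat)
  have g: "transpose_mat (Q k) *\<^sub>v x \<in> carrier_vec k" using Qt assms by simp
  have Qg: "Q k *\<^sub>v (transpose_mat (Q k) *\<^sub>v x) \<in> carrier_vec n" using Q g by simp
  have "residual k *\<^sub>v x = A *\<^sub>v x - (A * Q k * transpose_mat (Q k)) *\<^sub>v x"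
    unfolding residual_def P_B[OF assms(1)]
    by (rule minus_mult_distrib_mat_vec[OF A mult_carrier_mat[OF AQ Qt] assms(2)])
  also have "(A * Q k * transpose_mat (Q k)) *\<^sub>v x = A *\<^sub>v (Q k *\<^sub>v (transpose_mat (Q k) *\<^sub>v x))"
    by (simp only: assoc_mult_mat_vec[OF AQ Qt assms(2), symmetric] assoc_mult_mat_vec[OF A Q g, symmetric])
  finally show ?thesis
    by (simp add: orth_residual_def mult_minus_distrib_mat_vec[OF A assms(2) Qg])
qed

lemma residual_mult_orthogonal:
  assumes "k \<le> n" "w \<in> carrier_vec n" "\<forall>i\<in>{1..k}. q i \<bullet> w = 0"
  shows "residual k *\<^sub>v w = A *\<^sub>v w"
  using residual_mult[OF assms(1,2)] Qt_mult_eq_0_iff[OF assms(2)] assms(3)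
    orth_residual_of_orthogonal[OF Q_carrier assms(2)] by simp

section \<open>Lower bounds and strict decrease of the residual\<close>

lemma A_q_norm:
  assumes "j \<in> {1..n}"
  shows "(A *\<^sub>v q j) \<bullet> (A *\<^sub>v q j) = (\<alpha> j)\<^sup>2 + (\<beta> (j + 1))\<^sup>2"
proof -
  have c: "A *\<^sub>v q j \<in> carrier_vec m" using A q_carrier by simp
  have "p j \<bullet> (A *\<^sub>v q j) = \<alpha> j" "p (j + 1) \<bullet> (A *\<^sub>v q j) = \<beta> (j + 1)"
    using assms by (simp_all add: scalar_prod_A_q p_carrier p_orthonormal)
  then show ?thesis
    using comm_scalar_prod[OF c p_carrier, of j] comm_scalar_prod[OF c p_carrier, of "j + 1"]
    by (simp add: scalar_prod_A_q[OF assms c] power2_eq_square)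
qed

text \<open>The vector $q_{k+1}$ is orthogonal to all columns of $Q_k$, so the residual acts on it as \<open>A\<close>.\<close>

lemma gamma_lower:
  assumes "k + 1 \<le> n"
  shows "(\<alpha> (k + 1))\<^sup>2 + (\<beta> (k + 2))\<^sup>2 \<le> (lanczos_gamma A b k)\<^sup>2"
proof -
  have k: "k + 1 \<in> {1..n}" using assms by simp
  have "residual k *\<^sub>v q (k + 1) = A *\<^sub>v q (k + 1)"
    by (rule residual_mult_orthogonal) (use assms q_carrier q_orthonormal k in auto)
  then show ?thesis
    using mult_self_le_mat_norm2[OF residual_carrier[of k] q_carrier[of "k + 1"]]
      A_q_norm[OF k] q_orthonormal[OF k k] by (simp add: gamma_eq)
qed

text \<open>In the basis \<open>q\<close> the Gram matrix $A^T A$ is tridiagonal with off-diagonal entries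
  $\alpha_j \beta_j$, which are nonzero for $2 \<le> j \<le> n$; this drives the strict decrease of
  $\gamma_k$.\<close>

lemma Gram_tridiagonal:
  assumes "j \<in> {1..n}" "j + 1 \<le> n" "w \<in> carrier_vec n"
  shows "(A *\<^sub>v w) \<bullet> (A *\<^sub>v q j)
    = \<alpha> j * \<beta> j * (w \<bullet> q (j - 1)) + ((\<alpha> j)\<^sup>2 + (\<beta> (j + 1))\<^sup>2) * (w \<bullet> q j)
      + \<beta> (j + 1) * \<alpha> (j + 1) * (w \<bullet> q (j + 1))"
proof -
  have j1: "j + 1 \<in> {1..n}" using assms by simp
  have Aw: "A *\<^sub>v w \<in> carrier_vec m" using A assms(3) by simp
  have "(A *\<^sub>v w) \<bullet> (A *\<^sub>v q j)
      = \<alpha> j * (w \<bullet> (transpose_mat A *\<^sub>v p j)) + \<beta> (j + 1) * (w \<bullet> (transpose_mat A *\<^sub>v p (j + 1)))"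
    by (simp only: scalar_prod_A_q[OF assms(1) Aw] scalar_prod_adjoint[OF A assms(3) p_carrier])
  then show ?thesis
    using scalar_prod_At_p[OF assms(1,3)] scalar_prod_At_p[OF j1 assms(3)]
    by (simp add: power2_eq_square algebra_simps)
qed

text \<open>There are \<open>n\<close> orthonormal vectors \<open>q\<close> in dimension \<open>n\<close>.\<close>

lemma q_complete:
  assumes "w \<in> carrier_vec n" "\<And>i. i \<in> {1..n} \<Longrightarrow> q i \<bullet> w = 0"
  shows "w = 0\<^sub>v n"
proof -
  have Qt: "transpose_mat (Q n) \<in> carrier_mat n n" using Q_carrier by simp
  have "Q n * transpose_mat (Q n) = 1\<^sub>m n"
    using mat_mult_left_right_inverse[OF Qt Q_carrier] Q_orthonormal by simp
  moreover have "transpose_mat (Q n) *\<^sub>v w = 0\<^sub>v n"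
    using Qt_mult_eq_0_iff[OF assms(1)] assms(2) by simp
  ultimately show ?thesis using left_inverse_imp_injective[OF Q_carrier Qt _ assms(1)] by blast
qed

text \<open>Otherwise a maximiser \<open>w\<close> for the residual of index \<open>k + 1\<close> would be a singular vector of the residual
  of index \<open>k\<close>.  Its coordinates along $q_1,\dots,q_{k+1}$ vanish, so the three-term recurrence forces all
  others to vanish.\<close>

lemma gamma_decreasing:
  assumes "k + 2 \<le> n"
  shows "lanczos_gamma A b (k + 1) < lanczos_gamma A b k"
proof (rule ccontr)
  assume neg: "\<not> lanczos_gamma A b (k + 1) < lanczos_gamma A b k"
  define g where "g = (lanczos_gamma A b (k + 1))\<^sup>2"
  have le: "(mat_norm2 (residual k))\<^sup>2 \<le> g"
    using neg mat_norm2_nonneg[of "residual k"] unfolding g_def gamma_eq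
    by (intro power_mono) auto
  have g_pos: "g > 0"
  proof -
    have "0 < (\<alpha> (k + 1 + 1))\<^sup>2" using positive[of "k + 2"] assms by simp
    also have "\<dots> \<le> (\<alpha> (k + 1 + 1))\<^sup>2 + (\<beta> (k + 1 + 2))\<^sup>2" by simp
    also have "\<dots> \<le> g" unfolding g_def by (rule gamma_lower) (use assms in simp)
    finally show ?thesis .
  qed
  obtain x where x: "x \<in> carrier_vec n" "x \<noteq> 0\<^sub>v n"
    "(residual (k + 1) *\<^sub>v x) \<bullet> (residual (k + 1) *\<^sub>v x) = g * (x \<bullet> x)"
    using mat_norm2_attained[OF residual_carrier[of "k + 1"]] assms
    unfolding g_def gamma_eq by auto
  \<comment> \<open>Projecting the maximiser keeps its image and does not increase its norm, so \<open>w\<close> is a maximiser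
    as well.\<close>
  define w where "w = orth_residual (Q (k + 1)) x"
  have w: "w \<in> carrier_vec n"
    unfolding w_def by (rule orth_residual_carrier[OF Q_carrier x(1)])
  have w_le: "w \<bullet> w \<le> x \<bullet> x"
    unfolding w_def by (rule orth_residual_self_le[OF Q_carrier Q_orthonormal x(1)]) (use assms in simp)
  have orth: "\<forall>i\<in>{1..k + 1}. q i \<bullet> w = 0"
    using transpose_mult_orth_residual[OF Q_carrier Q_orthonormal x(1), of "k + 1"] assms
      Qt_mult_eq_0_iff[OF w, of "k + 1"] by (simp add: w_def)
  have Aw: "residual k *\<^sub>v w = A *\<^sub>v w"
    by (rule residual_mult_orthogonal) (use assms w orth in auto)
  have max: "(A *\<^sub>v w) \<bullet> (A *\<^sub>v w) = g * (x \<bullet> x)"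
    using x(3) residual_mult[OF _ x(1), of "k + 1"] assms by (simp add: w_def)
  have w_nz: "w \<noteq> 0\<^sub>v n"
  proof
    assume "w = 0\<^sub>v n"
    then have "A *\<^sub>v w = 0\<^sub>v m" using A by auto
    with max g_pos scalar_prod_self_pos[OF x(1,2)] show False by simp
  qed
  have "(mat_norm2 (residual k))\<^sup>2 * (w \<bullet> w) \<le> g * (x \<bullet> x)"
    by (rule mult_mono) (use le w_le g_pos scalar_prod_self_nonneg in auto)
  then have sing: "(A *\<^sub>v w) \<bullet> (residual k *\<^sub>v y) = (mat_norm2 (residual k))\<^sup>2 * (w \<bullet> y)"
    if "y \<in> carrier_vec n" for y
    using norm_maximiser_singular[OF residual_carrier[of k] w that] Aw max by simp
  have "q i \<bullet> w = 0" if "i \<in> {1..n}" for i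
    using that
  proof (induction i rule: less_induct)
    case (less i)
    show ?case
    proof (cases "i \<le> k + 1")
      case True
      then show ?thesis using orth less.prems by simp
    next
      case False
      then obtain j where j: "i = j + 1" "j \<ge> k + 1" using that[of "i - 1"] by simp
      have jn: "j \<in> {1..n}" "j + 1 \<le> n" using j less.prems by auto
      have 0: "w \<bullet> q j = 0" "w \<bullet> q (j - 1) = 0 \<or> j = 1"
        using less.IH[of j] less.IH[of "j - 1"] j jn comm_scalar_prod[OF w q_carrier] by auto
      \<comment> \<open>Testing the singular vector equation with $q_j$ leaves only the coordinate along $q_{j+1}$.\<close>
      have "residual k *\<^sub>v q j = A *\<^sub>v q j"
        by (rule residual_mult_orthogonal) (use j jn q_carrier q_orthonormal in auto)
      then have "(A *\<^sub>v w) \<bullet> (A *\<^sub>v q j) = 0"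
        using sing[OF q_carrier, of j] 0 by simp
      then have "\<beta> (j + 1) * \<alpha> (j + 1) * (w \<bullet> q (j + 1)) = 0"
        using Gram_tridiagonal[OF jn w] 0 beta_1 by auto
      then show ?thesis
        using positive[of j] positive[of "j + 1"] jn comm_scalar_prod[OF w q_carrier, of "j + 1"]
        by (simp add: j)
    qed
  qed
  with q_complete[OF w] w_nz show False by blast
qed

end

section \<open>The orthogonal complement of a graph\<close>

lemma one_plus_Gram_inverse:
  assumes D: "(\<Delta> :: real mat) \<in> carrier_mat l k"
  defines "N \<equiv> 1\<^sub>m k + transpose_mat \<Delta> * \<Delta>"
  shows "mat_inv N \<in> carrier_mat k k" "mat_inv N * N = 1\<^sub>m k"
proof -
  have Dt: "transpose_mat \<Delta> \<in> carrier_mat k l" using D by simp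
  have DD: "transpose_mat \<Delta> * \<Delta> \<in> carrier_mat k k" using D by simp
  have N: "N \<in> carrier_mat k k" using DD by (simp add: N_def)
  have "x = 0\<^sub>v k" if x: "x \<in> carrier_vec k" and 0: "N *\<^sub>v x = 0\<^sub>v k" for x
  proof -
    have Dx: "\<Delta> *\<^sub>v x \<in> carrier_vec l" using D x by simp
    have "N *\<^sub>v x = x + transpose_mat \<Delta> *\<^sub>v (\<Delta> *\<^sub>v x)"
      using x unfolding N_def assoc_mult_mat_vec[OF Dt D x, symmetric] by (simp add: add_mult_distrib_mat_vec[OF _ DD x])
    then have "x \<bullet> (N *\<^sub>v x) = x \<bullet> x + (\<Delta> *\<^sub>v x) \<bullet> (\<Delta> *\<^sub>v x)"
      using scalar_prod_add_distrib[OF x x mult_mat_vec_carrier[OF Dt Dx]]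
      by (simp add: scalar_prod_adjoint[OF D x Dx])
    then have "x \<bullet> x + (\<Delta> *\<^sub>v x) \<bullet> (\<Delta> *\<^sub>v x) = 0" using 0 x by simp
    then show ?thesis
      using scalar_prod_self_nonneg[of x] scalar_prod_self_nonneg[of "\<Delta> *\<^sub>v x"]
        scalar_prod_self_eq_0[OF x] by linarith
  qed
  then show "mat_inv N \<in> carrier_mat k k" "mat_inv N * N = 1\<^sub>m k"
    using injective_obtain_inverse[OF N] by auto
qed

text \<open>Here $(x_1,x_2) = (y_1,y_2) + (g, \Delta g)$ splits a vector along the graph of \<open>\<Delta>\<close>, and \<open>orth\<close> says
  that $(y_1,y_2)$ is orthogonal to every $(h, \Delta h)$.  Eliminating $y_1$ and $y_2$ from \<open>orth\<close> gives
  $(I + \Delta^T\Delta) g = x_1 + \Delta^T x_2$, and $y_1 = x_1 - g$ takes the stated form since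
  $I - J = J \Delta^T \Delta$.  The proof rewrites the right-hand side to $J (I + \Delta^T\Delta) y_1$.\<close>

lemma graph_complement_component:
  assumes D: "(\<Delta> :: real mat) \<in> carrier_mat l k"
    and x1: "x1 \<in> carrier_vec k" and x2: "x2 \<in> carrier_vec l"
    and y1: "y1 \<in> carrier_vec k" and y2: "y2 \<in> carrier_vec l"
    and g: "g \<in> carrier_vec k" and x1_eq: "x1 = y1 + g" and x2_eq: "x2 = y2 + \<Delta> *\<^sub>v g"
    and orth: "y1 + transpose_mat \<Delta> *\<^sub>v y2 = 0\<^sub>v k"
  defines "J \<equiv> mat_inv (1\<^sub>m k + transpose_mat \<Delta> * \<Delta>)"
  shows "y1 = (J * (transpose_mat \<Delta> * \<Delta>)) *\<^sub>v x1 - (J * transpose_mat \<Delta>) *\<^sub>v x2"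
proof -
  have Dt: "transpose_mat \<Delta> \<in> carrier_mat k l" using D by simp
  have DD: "transpose_mat \<Delta> * \<Delta> \<in> carrier_mat k k" using D by simp
  have J: "J \<in> carrier_mat k k" "J * (1\<^sub>m k + transpose_mat \<Delta> * \<Delta>) = 1\<^sub>m k"
    unfolding J_def by (rule one_plus_Gram_inverse[OF D])+
  define a where "a = transpose_mat \<Delta> *\<^sub>v y2"
  define d where "d = (transpose_mat \<Delta> * \<Delta>) *\<^sub>v y1"
  define e where "e = (transpose_mat \<Delta> * \<Delta>) *\<^sub>v g"
  have c: "a \<in> carrier_vec k" "d \<in> carrier_vec k" "e \<in> carrier_vec k"
    using Dt DD y1 y2 g by (auto simp: a_def d_def e_def)
  have 1: "(transpose_mat \<Delta> * \<Delta>) *\<^sub>v x1 = d + e"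
    using y1 g by (simp add: x1_eq d_def e_def mult_add_distrib_mat_vec[OF DD])
  have 2: "transpose_mat \<Delta> *\<^sub>v x2 = a + e"
    using mult_add_distrib_mat_vec[OF Dt y2, of "\<Delta> *\<^sub>v g"] D g
    by (simp add: x2_eq a_def e_def assoc_mult_mat_vec[OF Dt D g])
  have "(J * (transpose_mat \<Delta> * \<Delta>)) *\<^sub>v x1 - (J * transpose_mat \<Delta>) *\<^sub>v x2 = J *\<^sub>v (d + e) - J *\<^sub>v (a + e)"
    unfolding assoc_mult_mat_vec[OF J(1) DD x1] assoc_mult_mat_vec[OF J(1) Dt x2]
    unfolding 1 2 ..
  also have "\<dots> = J *\<^sub>v ((d + e) - (a + e))"
    using c by (intro mult_minus_distrib_mat_vec[OF J(1), symmetric]) auto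
  also have "(d + e) - (a + e) = y1 + d"
  proof (rule eq_vecI)
    fix i assume "i < dim_vec (y1 + d)"
    then have i: "i < k" using c by simp
    have "y1 $ i + a $ i = 0"
      using arg_cong[OF orth[folded a_def], of "\<lambda>v. v $ i"] i y1 c by simp
    then show "((d + e) - (a + e)) $ i = (y1 + d) $ i" using i y1 c by simp
  qed (use c in auto)
  also have "y1 + d = (1\<^sub>m k + transpose_mat \<Delta> * \<Delta>) *\<^sub>v y1"
    using y1 by (simp add: d_def add_mult_distrib_mat_vec[OF _ DD])
  also have "J *\<^sub>v \<dots> = y1"
    using y1 J DD by (simp add: assoc_mult_mat_vec[OF J(1) _ y1, symmetric])
  finally show ?thesis by (rule sym)
qed

text \<open>By the triangle inequality $\|u - v\| \<le> \sqrt{aX} + \sqrt{cY}$, and the square of the right-hand side is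
  at most $(a+c)(X+Y)$.  This is how the squared norm of a block row is bounded by the sum of the squared
  norms of its blocks.\<close>

lemma scalar_prod_diff_le:
  assumes u: "(u :: real Matrix.vec) \<in> carrier_vec d" and v: "v \<in> carrier_vec d"
    and ub: "u \<bullet> u \<le> a * X" and vb: "v \<bullet> v \<le> c * Y"
    and nonneg: "a \<ge> 0" "c \<ge> 0" "X \<ge> 0" "Y \<ge> 0"
  shows "(u - v) \<bullet> (u - v) \<le> (a + c) * (X + Y)"
proof -
  have "(u \<bullet> v)\<^sup>2 \<le> (u \<bullet> u) * (v \<bullet> v)" by (rule scalar_prod_Cauchy_Schwarz[OF u v])
  also have "\<dots> \<le> (a * X) * (c * Y)"
    by (rule mult_mono[OF ub vb]) (use nonneg scalar_prod_self_nonneg in auto)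
  finally have "(- (2 * (u \<bullet> v)))\<^sup>2 \<le> 4 * ((a * Y) * (c * X))" by (simp add: algebra_simps)
  also have "\<dots> \<le> (a * Y + c * X)\<^sup>2"
    using zero_le_power2[of "a * Y - c * X"] by (simp add: power2_eq_square algebra_simps)
  finally have "- (2 * (u \<bullet> v)) \<le> a * Y + c * X"
    by (rule power2_le_imp_le) (use nonneg in simp)
  then show ?thesis
    using scalar_prod_diff_self[OF u v, of 1] ub vb by (simp add: algebra_simps)
qed

section \<open>The Krylov subspace in singular coordinates\<close>

lemma mat_diag_mult_vec:
  assumes "y \<in> carrier_vec d"
  shows "mat_diag d f *\<^sub>v y = Matrix.vec d (\<lambda>i. f i * y $ i :: real)"
proof (rule eq_vecI)
  fix i assume "i < dim_vec (Matrix.vec d (\<lambda>i. f i * y $ i))"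
  then have i: "i < d" by simp
  have "(mat_diag d f *\<^sub>v y) $ i = (\<Sum>j\<in>{0..<d}. (if i = j then f j else 0) * y $ j)"
    using i assms by (simp add: mat_diag_def scalar_prod_def)
  also have "\<dots> = (\<Sum>j\<in>{0..<d}. if j = i then f i * y $ i else 0)"
    by (rule sum.cong) auto
  finally show "(mat_diag d f *\<^sub>v y) $ i = Matrix.vec d (\<lambda>i. f i * y $ i) $ i" using i by simp
qed (simp add: mat_diag_def)

lemma mat_diag_inverse:
  assumes "\<And>i. i < d \<Longrightarrow> f i \<noteq> (0 :: real)"
  shows "mat_inv (mat_diag d f) \<in> carrier_mat d d" "mat_inv (mat_diag d f) * mat_diag d f = 1\<^sub>m d"
proof -
  have inj: "y = 0\<^sub>v d" if "y \<in> carrier_vec d" "mat_diag d f *\<^sub>v y = 0\<^sub>v d" for y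
    using that assms by (auto simp: mat_diag_mult_vec vec_eq_iff)
  show "mat_inv (mat_diag d f) \<in> carrier_mat d d" "mat_inv (mat_diag d f) * mat_diag d f = 1\<^sub>m d"
    using injective_obtain_inverse[OF mat_diag_dim inj] by auto
qed

lemma poly_sum_lessThan:
  fixes h :: "real poly"
  assumes "degree h < k"
  shows "poly h x = (\<Sum>j<k. coeff h j * x ^ j)"
proof -
  have "(\<Sum>j<k. coeff h j * x ^ j) = (\<Sum>j\<le>degree h. coeff h j * x ^ j)"
    using assms by (intro sum.mono_neutral_right) (auto simp: coeff_eq_0)
  then show ?thesis by (simp add: poly_altdef)
qed

text \<open>A vector in the kernel holds the coefficients of a polynomial of degree below \<open>k\<close> with \<open>k\<close> distinct
  roots.\<close>

lemma Vandermonde_inverse: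
  fixes t :: "nat \<Rightarrow> real"
  assumes inj: "inj_on t {..<k}"
  defines "T \<equiv> mat k k (\<lambda>(i, j). t i ^ j)"
  shows "mat_inv T \<in> carrier_mat k k" "mat_inv T * T = 1\<^sub>m k"
proof -
  have T: "T \<in> carrier_mat k k" by (simp add: T_def)
  have "c = 0\<^sub>v k" if c: "c \<in> carrier_vec k" and 0: "T *\<^sub>v c = 0\<^sub>v k" for c
  proof (cases "k = 0")
    case True
    then show ?thesis using c by auto
  next
    case False
    define h where "h = (\<Sum>j<k. monom (c $ j) j)"
    have coeff_h: "coeff h i = (if i < k then c $ i else 0)" for i
      by (simp add: h_def coeff_sum)
    have "degree h \<le> k - 1" by (rule degree_le) (auto simp: coeff_h)
    then have deg: "degree h < k" using False by simp
    have roots: "t ` {..<k} \<subseteq> {x. poly h x = 0}"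
    proof (rule image_subsetI)
      fix i assume "i \<in> {..<k}"
      then have "(T *\<^sub>v c) $ i = (\<Sum>j<k. t i ^ j * c $ j)"
        using c by (simp add: T_def scalar_prod_def atLeast0LessThan)
      then have "poly h (t i) = 0"
        using \<open>i \<in> {..<k}\<close> 0 by (simp add: poly_sum_lessThan[OF deg] coeff_h mult.commute)
      then show "t i \<in> {x. poly h x = 0}" by simp
    qed
    have "h = 0"
    proof (rule ccontr)
      assume h: "h \<noteq> 0"
      have "k = card (t ` {..<k})" using inj by (simp add: card_image)
      also have "\<dots> \<le> card {x. poly h x = 0}"
        by (rule card_mono[OF poly_roots_finite[OF h] roots])
      also have "\<dots> \<le> degree h" by (rule card_poly_roots_bound[OF h])
      finally show False using deg by simp
    qed
    then have "\<And>i. i < k \<Longrightarrow> c $ i = 0" using coeff_h by (metis coeff_0)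
    then show ?thesis using c by auto
  qed
  then show "mat_inv T \<in> carrier_mat k k" "mat_inv T * T = 1\<^sub>m k"
    using injective_obtain_inverse[OF T] by auto
qed

lemma orthogonal_scalar_prod:
  assumes "orthogonal_matrix2 d W" "x \<in> carrier_vec d" "y \<in> carrier_vec d"
  shows "(transpose_mat W *\<^sub>v x) \<bullet> (transpose_mat W *\<^sub>v y) = x \<bullet> y"
proof -
  have W: "W \<in> carrier_mat d d" "W * transpose_mat W = 1\<^sub>m d"
    using assms(1) by (auto simp: orthogonal_matrix2_def)
  then have Wt: "transpose_mat W \<in> carrier_mat d d" by simp
  have "(transpose_mat W *\<^sub>v x) \<bullet> (transpose_mat W *\<^sub>v y) = x \<bullet> (W *\<^sub>v (transpose_mat W *\<^sub>v y))"
    using scalar_prod_adjoint[OF Wt assms(2) mult_mat_vec_carrier[OF Wt assms(3)]] by simp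
  also have "W *\<^sub>v (transpose_mat W *\<^sub>v y) = y"
    using assms(3) by (simp add: assoc_mult_mat_vec[OF W(1) Wt assms(3), symmetric] W(2))
  finally show ?thesis .
qed

locale lanczos_svd = lanczos_run +
  fixes U V :: "real mat" and \<sigma> :: "nat \<Rightarrow> real"
  assumes svd: "is_svd m n A U \<sigma> V"
    and sigma_pos: "\<And>i. i \<in> {1..n} \<Longrightarrow> \<sigma> i > 0"
    and sigma_decreasing: "\<And>i j. 1 \<le> i \<Longrightarrow> i < j \<Longrightarrow> j \<le> n \<Longrightarrow> \<sigma> i > \<sigma> j"
    and component_nonzero: "\<And>i. i \<in> {1..n} \<Longrightarrow> col U (i - 1) \<bullet> b \<noteq> 0"
begin

lemma U: "U \<in> carrier_mat m m" and V: "V \<in> carrier_mat n n"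
  and Ut: "transpose_mat U \<in> carrier_mat m m" and Vt: "transpose_mat V \<in> carrier_mat n n"
  and orth_U: "orthogonal_matrix2 m U" and orth_V: "orthogonal_matrix2 n V" and n_le_m: "n \<le> m"
  using svd by (auto simp: is_svd_def orthogonal_matrix2_def)

lemma Ut_A_mult:
  assumes x: "x \<in> carrier_vec n"
  shows "transpose_mat U *\<^sub>v (A *\<^sub>v x)
    = Matrix.vec m (\<lambda>i. if i < n then \<sigma> (Suc i) * (transpose_mat V *\<^sub>v x) $ i else 0)"
proof -
  define S where "S = mat_diag n (\<lambda>i. \<sigma> (Suc i)) @\<^sub>r 0\<^sub>m (m - n) n"
  have S: "S \<in> carrier_mat m n"
    using carrier_append_rows[OF mat_diag_dim zero_carrier_mat, of n "\<lambda>i. \<sigma> (Suc i)" "m - n"] n_le_m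
    by (simp add: S_def)
  define y where "y = transpose_mat V *\<^sub>v x"
  have y: "y \<in> carrier_vec n" using Vt x by (simp add: y_def)
  have Sy: "S *\<^sub>v y \<in> carrier_vec m" using S y by simp
  have US: "U * S \<in> carrier_mat m n" using U S by simp
  have "A = U * S * transpose_mat V" using svd by (simp add: is_svd_def S_def)
  then have "A *\<^sub>v x = U *\<^sub>v (S *\<^sub>v y)"
    unfolding y_def
    by (simp only: assoc_mult_mat_vec[OF US Vt x]
        assoc_mult_mat_vec[OF U S y[unfolded y_def], symmetric])
  then have "transpose_mat U *\<^sub>v (A *\<^sub>v x) = (transpose_mat U * U) *\<^sub>v (S *\<^sub>v y)"
    by (simp only: assoc_mult_mat_vec[OF Ut U Sy, symmetric])
  also have "\<dots> = S *\<^sub>v y"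
    using Sy orth_U by (simp add: orthogonal_matrix2_def)
  also have "\<dots> = Matrix.vec m (\<lambda>i. if i < n then \<sigma> (Suc i) * y $ i else 0)"
    unfolding S_def mat_mult_append[OF mat_diag_dim zero_carrier_mat y] mat_diag_mult_vec[OF y]
    using n_le_m y by (intro eq_vecI) (auto simp: append_vec_def)
  finally show ?thesis by (simp only: y_def)
qed

lemma col_U_carrier: "col U i \<in> carrier_vec m" and col_V_carrier: "col V i \<in> carrier_vec n"
  using U V by (auto intro: carrier_vecI)

lemma col_U_A_mult:
  assumes "i < n" "x \<in> carrier_vec n"
  shows "col U i \<bullet> (A *\<^sub>v x) = \<sigma> (Suc i) * (col V i \<bullet> x)"
proof -
  have "(transpose_mat U *\<^sub>v (A *\<^sub>v x)) $ i = \<sigma> (Suc i) * (transpose_mat V *\<^sub>v x) $ i"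
    using assms n_le_m by (simp add: Ut_A_mult)
  then show ?thesis using assms n_le_m U V by simp
qed

lemma col_V_At_mult:
  assumes i: "i < n" and y: "y \<in> carrier_vec m"
  shows "col V i \<bullet> (transpose_mat A *\<^sub>v y) = \<sigma> (Suc i) * (col U i \<bullet> y)"
proof -
  have v: "col V i \<in> carrier_vec n" using V i by simp
  have Av: "A *\<^sub>v col V i \<in> carrier_vec m" using A v by simp
  have "transpose_mat V *\<^sub>v col V i = unit_vec n i"
  proof -
    have "transpose_mat V * V = 1\<^sub>m n" using orth_V by (simp add: orthogonal_matrix2_def)
    then have "col (transpose_mat V * V) i = unit_vec n i" using i by simp
    then show ?thesis using col_mult2[OF Vt V i] by simp
  qed
  then have e: "transpose_mat U *\<^sub>v (A *\<^sub>v col V i) = \<sigma> (Suc i) \<cdot>\<^sub>v unit_vec m i"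
    using i n_le_m by (intro eq_vecI) (auto simp: Ut_A_mult[OF v])
  have "col V i \<bullet> (transpose_mat A *\<^sub>v y) = (A *\<^sub>v col V i) \<bullet> y"
    by (rule scalar_prod_adjoint[OF A v y, symmetric])
  also have "\<dots> = (transpose_mat U *\<^sub>v (A *\<^sub>v col V i)) \<bullet> (transpose_mat U *\<^sub>v y)"
    by (rule orthogonal_scalar_prod[OF orth_U Av y, symmetric])
  also have "\<dots> = \<sigma> (Suc i) * (col U i \<bullet> y)"
    using i n_le_m U mult_mat_vec_carrier[OF Ut y] unfolding e by simp
  finally show ?thesis .
qed

text \<open>The diagonal entries of the matrix \<open>D\<close>, which are also the coordinates of $A^T b$ in the basis of right
  singular vectors.\<close>

definition weight :: "nat \<Rightarrow> real" where
  "weight i = \<sigma> (Suc i) * (col U i \<bullet> b)"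

lemma weight_nonzero: "i < n \<Longrightarrow> weight i \<noteq> 0"
  using sigma_pos[of "Suc i"] component_nonzero[of "Suc i"] by (auto simp: weight_def)

text \<open>The Lanczos vectors are polynomials in $A A^T$ applied to \<open>b\<close> and in $A^T A$ applied to $A^T b$; passing
  from \<open>q\<close> to the next \<open>p\<close> raises the degree by one.  Each recurrence refers to the other, so both
  families are followed together.  For \<open>s = 0\<close> the subtraction in \<open>s - 1\<close> truncates, and $q_0 = 0$ is
  represented by the zero polynomial.\<close>

lemma lanczos_vectors_poly:
  "s \<le> n \<Longrightarrow>
    (\<exists>f. degree f \<le> s \<and> (\<forall>i<n. col U i \<bullet> p (s + 1) = (col U i \<bullet> b) * poly f ((\<sigma> (Suc i))\<^sup>2))) \<and>
    (\<exists>h. degree h \<le> s - 1 \<and> (\<forall>i<n. col V i \<bullet> q s = weight i * poly h ((\<sigma> (Suc i))\<^sup>2)))"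
proof (induction s)
  case 0
  have "col U i \<bullet> p 1 = (col U i \<bullet> b) * poly [:1 / vec_norm2 b:] ((\<sigma> (Suc i))\<^sup>2)" if "i < n" for i
    unfolding lanczos_start using b col_U_carrier[of i] by simp
  moreover have "col V i \<bullet> q 0 = weight i * poly 0 ((\<sigma> (Suc i))\<^sup>2)" if "i < n" for i
    unfolding lanczos_start using A col_V_carrier[of i] by simp
  ultimately show ?case
    by (intro conjI exI[of _ "[:1 / vec_norm2 b:]"] exI[of _ 0]) auto
next
  case (Suc s)
  have s: "Suc s \<in> {1..n}" using Suc.prems by simp
  obtain f h where f: "degree f \<le> s" "\<And>i. i < n \<Longrightarrow>
      col U i \<bullet> p (s + 1) = (col U i \<bullet> b) * poly f ((\<sigma> (Suc i))\<^sup>2)"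
    and h: "degree h \<le> s - 1" "\<And>i. i < n \<Longrightarrow> col V i \<bullet> q s = weight i * poly h ((\<sigma> (Suc i))\<^sup>2)"
    using Suc by auto
  define h' where "h' = smult (1 / \<alpha> (Suc s)) (f - smult (\<beta> (Suc s)) h)"
  define f' where "f' = smult (1 / \<beta> (Suc s + 1)) (pCons 0 h' - smult (\<alpha> (Suc s)) f)"
  have deg_h': "degree h' \<le> s"
    unfolding h'_def using f(1) h(1)
    by (intro order_trans[OF degree_smult_le] degree_diff_le) (auto intro: order_trans[OF degree_smult_le])
  have deg_f': "degree f' \<le> Suc s"
    unfolding f'_def using f(1) deg_h'
    by (intro order_trans[OF degree_smult_le] degree_diff_le)
       (auto intro: order_trans[OF degree_smult_le] order_trans[OF degree_pCons_le])
  have q_eq: "col V i \<bullet> q (Suc s) = weight i * poly h' ((\<sigma> (Suc i))\<^sup>2)" if i: "i < n" for i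
  proof -
    have "\<alpha> (Suc s) * (col V i \<bullet> q (Suc s))
        = \<sigma> (Suc i) * (col U i \<bullet> p (Suc s)) - \<beta> (Suc s) * (col V i \<bullet> q s)"
      using scalar_prod_At_p[OF s col_V_carrier, of i] col_V_At_mult[OF i p_carrier, of "Suc s"]
      by simp
    also have "\<dots> = \<alpha> (Suc s) * (weight i * poly h' ((\<sigma> (Suc i))\<^sup>2))"
      using f(2)[OF i] h(2)[OF i] positive[OF s]
      by (simp add: h'_def weight_def algebra_simps)
    finally show ?thesis using positive[OF s] by simp
  qed
  have "col U i \<bullet> p (Suc s + 1) = (col U i \<bullet> b) * poly f' ((\<sigma> (Suc i))\<^sup>2)" if i: "i < n" for i
  proof -
    have "\<beta> (Suc s + 1) * (col U i \<bullet> p (Suc s + 1))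
        = \<sigma> (Suc i) * (col V i \<bullet> q (Suc s)) - \<alpha> (Suc s) * (col U i \<bullet> p (Suc s))"
      using scalar_prod_A_q[OF s col_U_carrier, of i] col_U_A_mult[OF i q_carrier, of "Suc s"]
      by simp
    also have "\<dots> = \<beta> (Suc s + 1) * ((col U i \<bullet> b) * poly f' ((\<sigma> (Suc i))\<^sup>2))"
      using f(2)[OF i] q_eq[OF i] positive[OF s]
      by (simp add: f'_def weight_def algebra_simps power2_eq_square)
    finally show ?thesis using positive[OF s] by simp
  qed
  then show ?case using q_eq deg_f' deg_h' by auto
qed

text \<open>The coordinates of $Q_k g$ in the basis of right singular vectors.\<close>

definition coords :: "nat \<Rightarrow> real Matrix.vec \<Rightarrow> real Matrix.vec" where
  "coords k g = transpose_mat V *\<^sub>v (Q k *\<^sub>v g)"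

lemma coords_carrier: "g \<in> carrier_vec k \<Longrightarrow> coords k g \<in> carrier_vec n"
  unfolding coords_def using mult_mat_vec_carrier[OF Q_carrier] Vt by simp

lemma coords_poly:
  assumes k: "k \<ge> 1" "k \<le> n" and g: "g \<in> carrier_vec k"
  obtains h where "degree h < k"
    "\<And>i. i < n \<Longrightarrow> coords k g $ i = weight i * poly h ((\<sigma> (Suc i))\<^sup>2)"
proof -
  have "\<forall>j\<in>{..<k}. \<exists>h. degree h < k \<and>
      (\<forall>i<n. col V i \<bullet> q (Suc j) = weight i * poly h ((\<sigma> (Suc i))\<^sup>2))"
  proof
    fix j assume j: "j \<in> {..<k}"
    then obtain h where "degree h \<le> Suc j - 1"
      "\<forall>i<n. col V i \<bullet> q (Suc j) = weight i * poly h ((\<sigma> (Suc i))\<^sup>2)"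
      using lanczos_vectors_poly[of "Suc j"] k by auto
    with j show "\<exists>h. degree h < k \<and>
      (\<forall>i<n. col V i \<bullet> q (Suc j) = weight i * poly h ((\<sigma> (Suc i))\<^sup>2))"
      by (intro exI[of _ h]) simp
  qed
  from bchoice[OF this] obtain h where "\<forall>j\<in>{..<k}. degree (h j) < k \<and>
      (\<forall>i<n. col V i \<bullet> q (Suc j) = weight i * poly (h j) ((\<sigma> (Suc i))\<^sup>2))" ..
  then have h: "\<And>j. j < k \<Longrightarrow> degree (h j) < k"
    "\<And>i j. j < k \<Longrightarrow> i < n \<Longrightarrow> col V i \<bullet> q (Suc j) = weight i * poly (h j) ((\<sigma> (Suc i))\<^sup>2)"
    by simp_all
  show thesis
  proof (rule that[of "\<Sum>j<k. smult (g $ j) (h j)"])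
    have "degree (smult (g $ j) (h j)) \<le> k - 1" if "j < k" for j
      using degree_smult_le[of "g $ j" "h j"] h(1)[OF that] by simp
    then have "degree (\<Sum>j<k. smult (g $ j) (h j)) \<le> k - 1"
      by (intro degree_sum_le) auto
    then show "degree (\<Sum>j<k. smult (g $ j) (h j)) < k" using k by simp
  next
    fix i assume i: "i < n"
    have Qg: "Q k *\<^sub>v g \<in> carrier_vec n" using Q_carrier g by (rule mult_mat_vec_carrier)
    have "coords k g $ i = col V i \<bullet> (Q k *\<^sub>v g)"
      using i V by (simp add: coords_def)
    also have "\<dots> = (transpose_mat (Q k) *\<^sub>v col V i) \<bullet> g"
      using scalar_prod_adjoint[OF Q_carrier g, of "col V i"] i V
        comm_scalar_prod[OF g, of "transpose_mat (Q k) *\<^sub>v col V i"]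
        comm_scalar_prod[OF Qg, of "col V i"] Q_carrier[of k] by simp
    also have "\<dots> = (\<Sum>j<k. (q (Suc j) \<bullet> col V i) * g $ j)"
      using g Q_carrier[of k] by (simp add: scalar_prod_def[of _ g] atLeast0LessThan col_Q)
    also have "\<dots> = (\<Sum>j<k. weight i * poly (smult (g $ j) (h j)) ((\<sigma> (Suc i))\<^sup>2))"
    proof (rule sum.cong)
      fix j assume "j \<in> {..<k}"
      then show "(q (Suc j) \<bullet> col V i) * g $ j = weight i * poly (smult (g $ j) (h j)) ((\<sigma> (Suc i))\<^sup>2)"
        using h(2)[of j i] i V comm_scalar_prod[OF q_carrier, of "col V i" "Suc j"] by simp
    qed simp
    also have "\<dots> = weight i * poly (\<Sum>j<k. smult (g $ j) (h j)) ((\<sigma> (Suc i))\<^sup>2)"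
      by (simp only: poly_sum sum_distrib_left)
    finally show "coords k g $ i = weight i * poly (\<Sum>j<k. smult (g $ j) (h j)) ((\<sigma> (Suc i))\<^sup>2)" .
  qed
qed

abbreviation "\<Delta> \<equiv> krylov_Delta n U \<sigma> b"

text \<open>The blocks of \<open>D\<close> and $T_k$.  Even powers of \<open>\<sigma>\<close> are written as powers of the squares, so that $T_{k1}$ is
  visibly a Vandermonde matrix.\<close>

definition "D1 k = mat_diag k weight"
definition "D2 k = mat_diag (n - k) (\<lambda>i. weight (i + k))"
definition "T1 k = mat k k (\<lambda>(i, j). ((\<sigma> (Suc i))\<^sup>2) ^ j)"
definition "T2 k = mat (n - k) k (\<lambda>(i, j). ((\<sigma> (Suc (i + k)))\<^sup>2) ^ j)"

lemma Delta_eq: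
  assumes "k \<le> n"
  shows "\<Delta> k = D2 k * T2 k * mat_inv (T1 k) * mat_inv (D1 k)"
proof -
  have "mat k k (\<lambda>(i, j). krylov_D n U \<sigma> b $$ (i, j)) = D1 k"
    "mat (n - k) (n - k) (\<lambda>(i, j). krylov_D n U \<sigma> b $$ (i + k, j + k)) = D2 k"
    "mat k k (\<lambda>(i, j). krylov_T n \<sigma> k $$ (i, j)) = T1 k"
    "mat (n - k) k (\<lambda>(i, j). krylov_T n \<sigma> k $$ (i + k, j)) = T2 k"
    using assms by (auto simp: krylov_D_def krylov_T_def D1_def D2_def T1_def T2_def mat_diag_def
        weight_def power_mult intro!: eq_matI)
  moreover have "dim_row (krylov_D n U \<sigma> b) = n" "dim_col (krylov_D n U \<sigma> b) = n"
    "dim_row (krylov_T n \<sigma> k) = n" "dim_col (krylov_T n \<sigma> k) = k"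
    by (simp_all add: krylov_D_def krylov_T_def mat_diag_def)
  ultimately show ?thesis
    by (simp add: krylov_Delta_def split_block_def Let_def)
qed

lemma D1_inverse: "k \<le> n \<Longrightarrow> mat_inv (D1 k) \<in> carrier_mat k k"
  "k \<le> n \<Longrightarrow> mat_inv (D1 k) * D1 k = 1\<^sub>m k"
  unfolding D1_def using mat_diag_inverse[of k weight] weight_nonzero by auto

lemma T1_inverse: 
  assumes "k \<le> n"
  shows "mat_inv (T1 k) \<in> carrier_mat k k" "mat_inv (T1 k) * T1 k = 1\<^sub>m k"
proof -
  have "inj_on (\<lambda>i. (\<sigma> (Suc i))\<^sup>2) {..<k}"
  proof (rule linorder_inj_onI)
    fix i j assume ij: "i < j" "i \<in> {..<k}" "j \<in> {..<k}"
    then have "\<sigma> (Suc j) < \<sigma> (Suc i)" "0 < \<sigma> (Suc j)"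
      using sigma_decreasing[of "Suc i" "Suc j"] sigma_pos[of "Suc j"] assms by auto
    then show "(\<sigma> (Suc i))\<^sup>2 \<noteq> (\<sigma> (Suc j))\<^sup>2"
      by (simp add: power2_eq_iff)
  qed auto
  from Vandermonde_inverse[OF this]
  show "mat_inv (T1 k) \<in> carrier_mat k k" "mat_inv (T1 k) * T1 k = 1\<^sub>m k"
    by (simp_all add: T1_def)
qed

lemma Delta_carrier:
  assumes "k \<le> n"
  shows "\<Delta> k \<in> carrier_mat (n - k) k"
  unfolding Delta_eq[OF assms]
  using D1_inverse(1)[OF assms] T1_inverse(1)[OF assms]
  by (intro mult_carrier_mat) (auto simp: D2_def T2_def)

text \<open>If \<open>c\<close> is the coefficient vector of the polynomial that represents $Q_k g$, the coordinates are
  $D_1 T_{k1} c$ and $D_2 T_{k2} c$; eliminating \<open>c\<close> gives $\Delta_k$.\<close>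

lemma coords_on_graph:
  assumes k: "k \<ge> 1" "k \<le> n" and g: "g \<in> carrier_vec k"
  shows "vec_last (coords k g) (n - k) = \<Delta> k *\<^sub>v vec_first (coords k g) k"
proof -
  obtain h where h: "degree h < k"
    "\<And>i. i < n \<Longrightarrow> coords k g $ i = weight i * poly h ((\<sigma> (Suc i))\<^sup>2)"
    using coords_poly[OF k g] by blast
  define c where "c = Matrix.vec k (coeff h)"
  have c: "c \<in> carrier_vec k" by (simp add: c_def)
  have D1: "D1 k \<in> carrier_mat k k" and D2: "D2 k \<in> carrier_mat (n - k) (n - k)"
    and T1: "T1 k \<in> carrier_mat k k" and T2: "T2 k \<in> carrier_mat (n - k) k"
    by (simp_all add: D1_def D2_def T1_def T2_def)
  note iD1 = D1_inverse[OF k(2)] and iT1 = T1_inverse[OF k(2)]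
  have T1c: "T1 k *\<^sub>v c = Matrix.vec k (\<lambda>i. poly h ((\<sigma> (Suc i))\<^sup>2))"
    by (rule eq_vecI) (simp_all add: T1_def c_def scalar_prod_def atLeast0LessThan
        poly_sum_lessThan[OF h(1)] mult.commute)
  have T2c: "T2 k *\<^sub>v c = Matrix.vec (n - k) (\<lambda>i. poly h ((\<sigma> (Suc (i + k)))\<^sup>2))"
    by (rule eq_vecI) (simp_all add: T2_def c_def scalar_prod_def atLeast0LessThan
        poly_sum_lessThan[OF h(1)] mult.commute)
  have T1c': "T1 k *\<^sub>v c \<in> carrier_vec k" and T2c': "T2 k *\<^sub>v c \<in> carrier_vec (n - k)"
    using T1 T2 c by auto
  have first: "vec_first (coords k g) k = D1 k *\<^sub>v (T1 k *\<^sub>v c)"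
    unfolding D1_def mat_diag_mult_vec[OF T1c'] unfolding T1c
    by (rule eq_vecI) (use h(2) k in \<open>auto simp: vec_first_def\<close>)
  have last: "vec_last (coords k g) (n - k) = D2 k *\<^sub>v (T2 k *\<^sub>v c)"
    unfolding D2_def mat_diag_mult_vec[OF T2c'] unfolding T2c
    by (rule eq_vecI)
       (use h(2) k coords_carrier[OF g] in \<open>auto simp: vec_last_def add.commute\<close>)
  have DT: "D2 k * T2 k \<in> carrier_mat (n - k) k" using D2 T2 by simp
  have DTi: "D2 k * T2 k * mat_inv (T1 k) \<in> carrier_mat (n - k) k" using DT iT1 by simp
  have f: "D1 k *\<^sub>v (T1 k *\<^sub>v c) \<in> carrier_vec k" using D1 T1c' by simp
  have "\<Delta> k *\<^sub>v vec_first (coords k g) k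
      = (D2 k * T2 k * mat_inv (T1 k)) *\<^sub>v (mat_inv (D1 k) *\<^sub>v (D1 k *\<^sub>v (T1 k *\<^sub>v c)))"
    unfolding Delta_eq[OF k(2)] first by (rule assoc_mult_mat_vec[OF DTi iD1(1) f])
  also have "mat_inv (D1 k) *\<^sub>v (D1 k *\<^sub>v (T1 k *\<^sub>v c)) = T1 k *\<^sub>v c"
    using T1c' by (simp add: assoc_mult_mat_vec[OF iD1(1) D1 T1c', symmetric] iD1(2))
  also have "(D2 k * T2 k * mat_inv (T1 k)) *\<^sub>v (T1 k *\<^sub>v c)
      = (D2 k * T2 k) *\<^sub>v (mat_inv (T1 k) *\<^sub>v (T1 k *\<^sub>v c))"
    by (rule assoc_mult_mat_vec[OF DT iT1(1) T1c'])
  also have "mat_inv (T1 k) *\<^sub>v (T1 k *\<^sub>v c) = c"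
    using c by (simp add: assoc_mult_mat_vec[OF iT1(1) T1 c, symmetric] iT1(2))
  also have "(D2 k * T2 k) *\<^sub>v c = D2 k *\<^sub>v (T2 k *\<^sub>v c)"
    by (rule assoc_mult_mat_vec[OF D2 T2 c])
  finally show ?thesis using last by simp
qed

lemma first_last_append:
  assumes "v \<in> carrier_vec n" "k \<le> n"
  shows "vec_first v k @\<^sub>v vec_last v (n - k) = v"
  using vec_first_last_append[of v k "n - k"] assms by simp

lemma scalar_prod_first_last:
  assumes "v \<in> carrier_vec n" "w \<in> carrier_vec n" "k \<le> n"
  shows "(v :: real Matrix.vec) \<bullet> w
    = vec_first v k \<bullet> vec_first w k + vec_last v (n - k) \<bullet> vec_last w (n - k)"
  using scalar_prod_append[of "vec_first v k" k "vec_last v (n - k)" "n - k" "vec_first w k" "vec_last w (n - k)"]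
    first_last_append[OF assms(1,3)] first_last_append[OF assms(2,3)] by simp

lemma coords_scalar_prod:
  assumes "w \<in> carrier_vec n" "g \<in> carrier_vec k"
  shows "(transpose_mat V *\<^sub>v w) \<bullet> coords k g = w \<bullet> (Q k *\<^sub>v g)"
  unfolding coords_def
  by (rule orthogonal_scalar_prod[OF orth_V assms(1) mult_mat_vec_carrier[OF Q_carrier assms(2)]])

text \<open>The projection of the graph to its first \<open>k\<close> coordinates is injective, and the columns of $Q_k$ are
  independent; so the square matrix \<open>G\<close> of this map is injective, hence invertible.  The Krylov
  space therefore fills the whole graph.\<close>

lemma coords_first_surjective:
  assumes k: "k \<ge> 1" "k \<le> n" and h: "h \<in> carrier_vec k"
  obtains g where "g \<in> carrier_vec k" "vec_first (coords k g) k = h"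
proof -
  define W where "W = transpose_mat V * Q k"
  define G where "G = mat k k (\<lambda>(i, j). W $$ (i, j))"
  have G: "G \<in> carrier_mat k k" by (simp add: G_def)
  have W: "W \<in> carrier_mat n k"
    unfolding W_def using Vt Q_carrier by (rule mult_carrier_mat)
  have Gg: "G *\<^sub>v g = vec_first (coords k g) k" if "g \<in> carrier_vec k" for g
  proof -
    have "coords k g = W *\<^sub>v g"
      unfolding coords_def W_def by (rule assoc_mult_mat_vec[OF Vt Q_carrier that, symmetric])
    then show ?thesis
      using W that k
      by (intro eq_vecI) (auto simp: G_def vec_first_def scalar_prod_def)
  qed
  have inj: "g = 0\<^sub>v k" if g: "g \<in> carrier_vec k" and 0: "G *\<^sub>v g = 0\<^sub>v k" for g
  proof -
    have first: "vec_first (coords k g) k = 0\<^sub>v k" using Gg[OF g] 0 by simp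
    then have "vec_last (coords k g) (n - k) = 0\<^sub>v (n - k)"
      using coords_on_graph[OF k g] Delta_carrier[OF k(2)] by auto
    then have "coords k g \<bullet> coords k g = 0"
      using scalar_prod_first_last[OF coords_carrier[OF g] coords_carrier[OF g] k(2)] first by simp
    moreover have Qg: "Q k *\<^sub>v g \<in> carrier_vec n" using Q_carrier g by (rule mult_mat_vec_carrier)
    ultimately have "(Q k *\<^sub>v g) \<bullet> (Q k *\<^sub>v g) = 0"
      using orthogonal_scalar_prod[OF orth_V Qg Qg] by (simp add: coords_def)
    then have "Q k *\<^sub>v g = 0\<^sub>v n" by (rule scalar_prod_self_eq_0[OF Qg])
    moreover have "transpose_mat (Q k) *\<^sub>v (Q k *\<^sub>v g) = g"
      using g Q_carrier[of k] assoc_mult_mat_vec[OF _ Q_carrier g, of "transpose_mat (Q k)" k, symmetric]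
        Q_orthonormal[OF k(2)] by simp
    ultimately show "g = 0\<^sub>v k" using Q_carrier[of k] by auto
  qed
  note inv = injective_obtain_inverse[OF G inj]
  have "G *\<^sub>v (mat_inv G *\<^sub>v h) = h"
    using inv(1) h by (simp add: assoc_mult_mat_vec[OF G inv(1) h, symmetric] inv(2))
  then show thesis
    using that[of "mat_inv G *\<^sub>v h"] Gg[of "mat_inv G *\<^sub>v h"] inv(1) h by simp
qed

section \<open>The upper bound\<close>

text \<open>In singular coordinates \<open>A\<close> multiplies the entries beyond the first \<open>k\<close> by at most $\sigma_{k+1}$.\<close>

lemma A_mult_norm_le:
  assumes w: "w \<in> carrier_vec n" and k: "k < n"
  defines "y1 \<equiv> vec_first (transpose_mat V *\<^sub>v w) k"
    and "S \<equiv> mat_diag k (\<lambda>i. \<sigma> (Suc i))"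
  shows "(A *\<^sub>v w) \<bullet> (A *\<^sub>v w) \<le> (S *\<^sub>v y1) \<bullet> (S *\<^sub>v y1) + (\<sigma> (k + 1))\<^sup>2 * (w \<bullet> w)"
proof -
  define y where "y = transpose_mat V *\<^sub>v w"
  have y: "y \<in> carrier_vec n" using Vt w by (simp add: y_def)
  have Aw: "A *\<^sub>v w \<in> carrier_vec m" using A w by simp
  have "(A *\<^sub>v w) \<bullet> (A *\<^sub>v w) = (transpose_mat U *\<^sub>v (A *\<^sub>v w)) \<bullet> (transpose_mat U *\<^sub>v (A *\<^sub>v w))"
    by (rule orthogonal_scalar_prod[OF orth_U Aw Aw, symmetric])
  also have "\<dots> = (\<Sum>i<m. if i < n then (\<sigma> (Suc i) * y $ i)\<^sup>2 else 0)"
    unfolding Ut_A_mult[OF w] y_def[symmetric]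
    by (auto simp: scalar_prod_def atLeast0LessThan power2_eq_square intro!: sum.cong)
  also have "\<dots> = (\<Sum>i<n. (\<sigma> (Suc i) * y $ i)\<^sup>2)"
    using n_le_m by (intro sum.mono_neutral_cong_right) auto
  also have "\<dots> = (\<Sum>i<k. (\<sigma> (Suc i) * y $ i)\<^sup>2) + (\<Sum>i=k..<n. (\<sigma> (Suc i) * y $ i)\<^sup>2)"
    using k sum.atLeastLessThan_concat[of 0 k n "\<lambda>i. (\<sigma> (Suc i) * y $ i)\<^sup>2"]
    by (simp add: atLeast0LessThan)
  also have "(\<Sum>i<k. (\<sigma> (Suc i) * y $ i)\<^sup>2) = (S *\<^sub>v y1) \<bullet> (S *\<^sub>v y1)"
  proof -
    have "y1 \<in> carrier_vec k" by (simp add: y1_def)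
    from mat_diag_mult_vec[OF this]
    show ?thesis
      by (simp add: S_def scalar_prod_def atLeast0LessThan power2_eq_square)
         (simp add: y1_def y_def[symmetric] vec_first_def)
  qed
  also have "(\<Sum>i=k..<n. (\<sigma> (Suc i) * y $ i)\<^sup>2) \<le> (\<Sum>i=k..<n. (\<sigma> (k + 1))\<^sup>2 * (y $ i)\<^sup>2)"
  proof (rule sum_mono)
    fix i assume i: "i \<in> {k..<n}"
    have "\<sigma> (Suc i) \<le> \<sigma> (k + 1)"
      using i sigma_decreasing[of "k + 1" "Suc i"] by (cases "i = k") auto
    moreover have "\<sigma> (Suc i) > 0" using sigma_pos[of "Suc i"] i by auto
    ultimately have "(\<sigma> (Suc i))\<^sup>2 \<le> (\<sigma> (k + 1))\<^sup>2" by (intro power_mono) auto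
    then show "(\<sigma> (Suc i) * y $ i)\<^sup>2 \<le> (\<sigma> (k + 1))\<^sup>2 * (y $ i)\<^sup>2"
      by (simp add: power_mult_distrib mult_right_mono)
  qed
  also have "\<dots> = (\<sigma> (k + 1))\<^sup>2 * (\<Sum>i=k..<n. (y $ i)\<^sup>2)"
    by (simp add: sum_distrib_left)
  also have "\<dots> \<le> (\<sigma> (k + 1))\<^sup>2 * (\<Sum>i<n. (y $ i)\<^sup>2)"
    by (intro mult_left_mono sum_mono2) auto
  also have "(\<Sum>i<n. (y $ i)\<^sup>2) = w \<bullet> w"
    using orthogonal_scalar_prod[OF orth_V w w] y
    by (simp add: y_def[symmetric] scalar_prod_def[of y] atLeast0LessThan power2_eq_square)
  finally show ?thesis by simp
qed

text \<open>Let $w = x - Q_k Q_k^T x$ have the singular coordinates \<open>y\<close>.  Since \<open>w\<close> is orthogonal to the Krylov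
  space, \<open>y\<close> is orthogonal to the graph of $\Delta_k$.  Hence $\Sigma_k y_1$ is given by the two matrices
  in the definition of $\eta_k$, and the remaining part of $Aw$ has norm at most $\sigma_{k+1}\|x\|$.\<close>

lemma gamma_sq_upper:
  assumes k: "k \<ge> 1" "k < n"
  shows "(lanczos_gamma A b k)\<^sup>2 \<le> eta_rhs n U \<sigma> b k + (\<sigma> (k + 1))\<^sup>2"
proof -
  have kn: "k \<le> n" using k by simp
  define S where "S = mat_diag k (\<lambda>i. \<sigma> (Suc i))"
  define E where "E = \<Delta> k"
  define J where "J = mat_inv (1\<^sub>m k + transpose_mat E * E)"
  define M1 where "M1 = S * J * (transpose_mat E * E)"
  define M2 where "M2 = S * J * transpose_mat E"
  have rhs: "eta_rhs n U \<sigma> b k = (mat_norm2 M1)\<^sup>2 + (mat_norm2 M2)\<^sup>2"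
    by (simp add: eta_rhs_def Let_def M1_def M2_def J_def E_def S_def)
  have S: "S \<in> carrier_mat k k" by (simp add: S_def)
  have E: "E \<in> carrier_mat (n - k) k" using Delta_carrier[OF kn] by (simp add: E_def)
  have Et: "transpose_mat E \<in> carrier_mat k (n - k)" and EE: "transpose_mat E * E \<in> carrier_mat k k"
    using E by auto
  have J: "J \<in> carrier_mat k k" using one_plus_Gram_inverse(1)[OF E] by (simp add: J_def)
  have JE: "J * transpose_mat E \<in> carrier_mat k (n - k)" "J * (transpose_mat E * E) \<in> carrier_mat k k"
    using J Et EE by auto
  have M1: "M1 \<in> carrier_mat k k" and M2: "M2 \<in> carrier_mat k (n - k)"
    using S J Et EE by (auto simp: M1_def M2_def)
  have M1': "M1 = S * (J * (transpose_mat E * E))" and M2': "M2 = S * (J * transpose_mat E)"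
    unfolding M1_def M2_def by (rule assoc_mult_mat[OF S J EE], rule assoc_mult_mat[OF S J Et])
  show ?thesis
    unfolding gamma_eq
  proof (rule mat_norm2_sq_le[OF residual_carrier])
    show "0 \<le> eta_rhs n U \<sigma> b k + (\<sigma> (k + 1))\<^sup>2" by (simp add: rhs)
    fix x :: "real Matrix.vec" assume x: "x \<in> carrier_vec n"
    define w where "w = orth_residual (Q k) x"
    define g where "g = transpose_mat (Q k) *\<^sub>v x"
    have w: "w \<in> carrier_vec n" unfolding w_def by (rule orth_residual_carrier[OF Q_carrier x])
    have g: "g \<in> carrier_vec k" using Q_carrier[of k] x by (simp add: g_def)
    have Qg: "Q k *\<^sub>v g \<in> carrier_vec n" using Q_carrier g by (rule mult_mat_vec_carrier)
    have w_le: "w \<bullet> w \<le> x \<bullet> x"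
      unfolding w_def by (rule orth_residual_self_le[OF Q_carrier Q_orthonormal[OF kn] x])
    define x' y z where "x' = transpose_mat V *\<^sub>v x" and "y = transpose_mat V *\<^sub>v w"
      and "z = coords k g"
    have c: "x' \<in> carrier_vec n" "y \<in> carrier_vec n" "z \<in> carrier_vec n"
      using Vt x w coords_carrier[OF g] by (auto simp: x'_def y_def z_def)
    have "x = w + Q k *\<^sub>v g"
      unfolding w_def orth_residual_def g_def[symmetric] using x Q_carrier[of k]
      by (intro eq_vecI) auto
    then have xyz: "x' = y + z"
      unfolding x'_def y_def z_def coords_def using mult_add_distrib_mat_vec[OF Vt w Qg] by simp
    define x1 y1 z1 x2 y2 where "x1 = vec_first x' k" and "y1 = vec_first y k"
      and "z1 = vec_first z k" and "x2 = vec_last x' (n - k)" and "y2 = vec_last y (n - k)"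
    have c': "x1 \<in> carrier_vec k" "y1 \<in> carrier_vec k" "z1 \<in> carrier_vec k"
      "x2 \<in> carrier_vec (n - k)" "y2 \<in> carrier_vec (n - k)"
      by (simp_all add: x1_def y1_def z1_def x2_def y2_def)
    have x1: "x1 = y1 + z1"
      using c kn by (intro eq_vecI) (auto simp: xyz x1_def y1_def z1_def vec_first_def)
    have "vec_last z (n - k) = E *\<^sub>v z1"
      unfolding z_def z1_def E_def by (rule coords_on_graph[OF k(1) kn g])
    moreover have "x2 = y2 + vec_last z (n - k)"
      using c kn by (intro eq_vecI) (auto simp: xyz x2_def y2_def vec_last_def)
    ultimately have x2: "x2 = y2 + E *\<^sub>v z1" by simp
    \<comment> \<open>The left side \<open>h\<close> is tested against the graph point over \<open>h\<close> itself.\<close>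
    have orth: "y1 + transpose_mat E *\<^sub>v y2 = 0\<^sub>v k"
    proof -
      define h where "h = y1 + transpose_mat E *\<^sub>v y2"
      have Ey: "transpose_mat E *\<^sub>v y2 \<in> carrier_vec k" using Et c' by simp
      have h: "h \<in> carrier_vec k" using c' Ey by (simp add: h_def)
      obtain g' where g': "g' \<in> carrier_vec k" "vec_first (coords k g') k = h"
        using coords_first_surjective[OF k(1) kn h] by blast
      have "y \<bullet> coords k g' = w \<bullet> (Q k *\<^sub>v g')"
        unfolding y_def by (rule coords_scalar_prod[OF w g'(1)])
      also have "\<dots> = (Q k *\<^sub>v g') \<bullet> w"
        by (rule comm_scalar_prod[OF w mult_mat_vec_carrier[OF Q_carrier g'(1)]])
      also have "\<dots> = g' \<bullet> (transpose_mat (Q k) *\<^sub>v w)"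
        by (rule scalar_prod_adjoint[OF Q_carrier g'(1) w])
      also have "\<dots> = 0"
        using g' transpose_mult_orth_residual[OF Q_carrier Q_orthonormal[OF kn] x]
        by (simp add: w_def)
      finally have "y1 \<bullet> h + y2 \<bullet> (E *\<^sub>v h) = 0"
        using scalar_prod_first_last[OF c(2) coords_carrier[OF g'(1)] kn]
          coords_on_graph[OF k(1) kn g'(1)] g'(2)
        by (simp add: y1_def y2_def E_def)
      moreover have "y2 \<bullet> (E *\<^sub>v h) = (transpose_mat E *\<^sub>v y2) \<bullet> h"
        using scalar_prod_adjoint[OF Et c'(5) h] by simp
      ultimately have "h \<bullet> h = 0"
        using add_scalar_prod_distrib[OF c'(2) Ey h] by (simp add: h_def[symmetric])
      then show ?thesis using scalar_prod_self_eq_0[OF h] by (simp add: h_def)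
    qed
    have "y1 = (J * (transpose_mat E * E)) *\<^sub>v x1 - (J * transpose_mat E) *\<^sub>v x2"
      unfolding J_def
      by (rule graph_complement_component[OF E c'(1,4,2,5,3) x1 x2 orth])
    then have "S *\<^sub>v y1 = S *\<^sub>v ((J * (transpose_mat E * E)) *\<^sub>v x1) - S *\<^sub>v ((J * transpose_mat E) *\<^sub>v x2)"
      using mult_minus_distrib_mat_vec[OF S mult_mat_vec_carrier[OF JE(2) c'(1)]
          mult_mat_vec_carrier[OF JE(1) c'(4)]] by simp
    also have "\<dots> = M1 *\<^sub>v x1 - M2 *\<^sub>v x2"
      unfolding M1' M2'
      unfolding assoc_mult_mat_vec[OF S JE(2) c'(1), symmetric] assoc_mult_mat_vec[OF S JE(1) c'(4), symmetric] ..
    finally have Sy1: "S *\<^sub>v y1 = M1 *\<^sub>v x1 - M2 *\<^sub>v x2" .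
    have "(S *\<^sub>v y1) \<bullet> (S *\<^sub>v y1) \<le> ((mat_norm2 M1)\<^sup>2 + (mat_norm2 M2)\<^sup>2) * (x1 \<bullet> x1 + x2 \<bullet> x2)"
      unfolding Sy1
      by (rule scalar_prod_diff_le[OF mult_mat_vec_carrier[OF M1 c'(1)] mult_mat_vec_carrier[OF M2 c'(4)]
          mult_self_le_mat_norm2[OF M1 c'(1)] mult_self_le_mat_norm2[OF M2 c'(4)]])
        (simp_all add: scalar_prod_self_nonneg)
    also have "x1 \<bullet> x1 + x2 \<bullet> x2 = x' \<bullet> x'"
      unfolding x1_def x2_def by (rule scalar_prod_first_last[OF c(1) c(1) kn, symmetric])
    also have "\<dots> = x \<bullet> x"
      unfolding x'_def by (rule orthogonal_scalar_prod[OF orth_V x x])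
    finally have top: "(S *\<^sub>v y1) \<bullet> (S *\<^sub>v y1) \<le> eta_rhs n U \<sigma> b k * (x \<bullet> x)" by (simp add: rhs)
    have "(residual k *\<^sub>v x) \<bullet> (residual k *\<^sub>v x) = (A *\<^sub>v w) \<bullet> (A *\<^sub>v w)"
      using residual_mult[OF kn x] by (simp add: w_def)
    also have "\<dots> \<le> (S *\<^sub>v y1) \<bullet> (S *\<^sub>v y1) + (\<sigma> (k + 1))\<^sup>2 * (w \<bullet> w)"
      unfolding S_def y1_def y_def by (rule A_mult_norm_le[OF w k(2)])
    also have "\<dots> \<le> eta_rhs n U \<sigma> b k * (x \<bullet> x) + (\<sigma> (k + 1))\<^sup>2 * (x \<bullet> x)"
      by (intro add_mono top mult_left_mono w_le) simp
    finally show "(residual k *\<^sub>v x) \<bullet> (residual k *\<^sub>v x)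
        \<le> (eta_rhs n U \<sigma> b k + (\<sigma> (k + 1))\<^sup>2) * (x \<bullet> x)"
      by (simp add: distrib_right)
  qed
qed

lemma gamma_sq_upper_eta:
  assumes k: "k \<in> {1..n - 1}"
  shows "(lanczos_gamma A b k)\<^sup>2 \<le> (1 + (eta n U \<sigma> b k)\<^sup>2) * (\<sigma> (k + 1))\<^sup>2"
proof -
  have k': "k \<ge> 1" "k < n" using k by auto
  then have "\<sigma> (k + 1) > 0" using sigma_pos[of "k + 1"] by simp
  then have "(eta n U \<sigma> b k)\<^sup>2 * (\<sigma> (k + 1))\<^sup>2 = eta_rhs n U \<sigma> b k"
    using eta_unique[of \<sigma> k "eta n U \<sigma> b k" n U b] by simp
  then show ?thesis
    using gamma_sq_upper[OF k'] by (simp add: distrib_right add.commute)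
qed

end

theorem theorem9:
  fixes A U V :: "real mat" and b :: "real Matrix.vec" and \<sigma> :: "nat \<Rightarrow> real" and m n :: nat
  assumes "A \<in> carrier_mat m n" and "b \<in> carrier_vec m"
    and "is_svd m n A U \<sigma> V"
    and "\<And>i. i \<in> {1..n} \<Longrightarrow> \<sigma> i > 0"
    and "\<And>i j. 1 \<le> i \<Longrightarrow> i < j \<Longrightarrow> j \<le> n \<Longrightarrow> \<sigma> i > \<sigma> j"
    and "\<And>i. i \<in> {1..n} \<Longrightarrow> col U (i - 1) \<bullet> b \<noteq> 0"
    and "\<And>i. i \<in> {1..n} \<Longrightarrow> lanczos_alpha A b i > 0 \<and> lanczos_beta A b (i + 1) > 0"
  shows "(\<forall>k\<in>{1..n - 1}.
            lanczos_alpha A b (k + 1) < lanczos_gamma A b k \<and>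
            lanczos_gamma A b k \<le> sqrt (1 + (eta n U \<sigma> b k)\<^sup>2) * \<sigma> (k + 1)) \<and>
         (\<forall>k\<in>{1..n - 1}.
            lanczos_beta A b (k + 2) < lanczos_gamma A b k \<and>
            lanczos_gamma A b k \<le> sqrt (1 + (eta n U \<sigma> b k)\<^sup>2) * \<sigma> (k + 1)) \<and>
         (\<forall>k\<in>{1..n - 1}.
            lanczos_alpha A b (k + 1) * lanczos_beta A b (k + 2) \<le> (lanczos_gamma A b k)\<^sup>2 / 2 \<and>
            (lanczos_gamma A b k)\<^sup>2 / 2 \<le> (1 + (eta n U \<sigma> b k)\<^sup>2) * (\<sigma> (k + 1))\<^sup>2 / 2) \<and>
         (\<forall>k\<in>{1..n - 2}. lanczos_gamma A b (k + 1) < lanczos_gamma A b k)"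
proof (cases "n = 0")
  case True
  then show ?thesis by simp
next
  case False
  have U: "U \<in> carrier_mat m m" "n \<le> m"
    using assms(3) by (auto simp: is_svd_def orthogonal_matrix2_def)
  have b_nz: "b \<noteq> 0\<^sub>v m"
  proof
    assume "b = 0\<^sub>v m"
    then have "col U 0 \<bullet> b = 0" using U False by (simp add: scalar_prod_def)
    then show False using assms(6)[of 1] False by simp
  qed
  interpret lanczos_svd A b m n U V \<sigma>
    by unfold_locales (fact assms b_nz)+
  have bounds: "\<alpha> (k + 1) < lanczos_gamma A b k" "\<beta> (k + 2) < lanczos_gamma A b k"
    "\<alpha> (k + 1) * \<beta> (k + 2) \<le> (lanczos_gamma A b k)\<^sup>2 / 2"
    "(lanczos_gamma A b k)\<^sup>2 / 2 \<le> (1 + (eta n U \<sigma> b k)\<^sup>2) * (\<sigma> (k + 1))\<^sup>2 / 2"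
    "lanczos_gamma A b k \<le> sqrt (1 + (eta n U \<sigma> b k)\<^sup>2) * \<sigma> (k + 1)"
    if k: "k \<in> {1..n - 1}" for k
  proof -
    have low: "(\<alpha> (k + 1))\<^sup>2 + (\<beta> (k + 2))\<^sup>2 \<le> (lanczos_gamma A b k)\<^sup>2"
      by (rule gamma_lower) (use k in auto)
    have pos: "\<alpha> (k + 1) > 0" "\<beta> (k + 2) > 0"
      using positive[of "k + 1"] k by auto
    have g: "lanczos_gamma A b k \<ge> 0" by (simp add: gamma_eq mat_norm2_nonneg)
    have "(\<alpha> (k + 1))\<^sup>2 < (lanczos_gamma A b k)\<^sup>2" "(\<beta> (k + 2))\<^sup>2 < (lanczos_gamma A b k)\<^sup>2"
      using low zero_less_power[OF pos(1), of 2] zero_less_power[OF pos(2), of 2] by linarith+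
    then show "\<alpha> (k + 1) < lanczos_gamma A b k" "\<beta> (k + 2) < lanczos_gamma A b k"
      using power_less_imp_less_base[OF _ g] by blast+
    show "\<alpha> (k + 1) * \<beta> (k + 2) \<le> (lanczos_gamma A b k)\<^sup>2 / 2"
      using low sum_squares_bound[of "\<alpha> (k + 1)" "\<beta> (k + 2)"] by simp
    note up = gamma_sq_upper_eta[OF k]
    then show "(lanczos_gamma A b k)\<^sup>2 / 2 \<le> (1 + (eta n U \<sigma> b k)\<^sup>2) * (\<sigma> (k + 1))\<^sup>2 / 2"
      by simp
    have "\<sigma> (k + 1) > 0" using sigma_pos[of "k + 1"] k by auto
    then have "0 \<le> sqrt (1 + (eta n U \<sigma> b k)\<^sup>2) * \<sigma> (k + 1)" by simp
    moreover have "(lanczos_gamma A b k)\<^sup>2 \<le> (sqrt (1 + (eta n U \<sigma> b k)\<^sup>2) * \<sigma> (k + 1))\<^sup>2"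
      using up by (simp add: power_mult_distrib)
    ultimately show "lanczos_gamma A b k \<le> sqrt (1 + (eta n U \<sigma> b k)\<^sup>2) * \<sigma> (k + 1)"
      by (rule power2_le_imp_le[rotated])
  qed
  moreover have "lanczos_gamma A b (k + 1) < lanczos_gamma A b k" if "k \<in> {1..n - 2}" for k
    by (rule gamma_decreasing) (use that in auto)
  ultimately show ?thesis by blast
qed

end
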